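(* If $\Lambda$ is an endomorphism of $\mathcal{Q}_2$ such that $\Lambda(x)=x$ for every $x\in\mathcal{O}_2$, then $\Lambda=\mathrm{id}_{\mathcal{Q}_2}$.
   Context: The $2$-adic ring $C^*$-algebra $\mathcal{Q}_2$ is the universal (unital) $C^*$-algebra generated by a unitary $U$ and an isometry $S_2$ satisfying $S_2U=U^2S_2$ and $S_2S_2^*+US_2S_2^*U^*=1$. Put $S_1:=US_2$. The Cuntz algebra $\mathcal{O}_2$ is regarded as the $C^*$-subalgebra $C^*(S_1,S_2)\subset\mathcal{Q}_2$. All endomorphisms are unital and $*$-preserving. *)

theory Defs
  imports "HOL-Analysis.Analysis" "HOL-Library.Poly_Mapping"
begin

section \<open>Unital C*-algebras\<close>

text \<open>All algebras are complex and unital; the class \<^class>\<open>real_normed_algebra_1\<close> contributes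
  \<open>1 \<noteq> 0\<close>, so the zero algebra is not an instance.\<close>

class cstar_algebra = real_normed_algebra_1 + banach +
  fixes scaleC :: "complex \<Rightarrow> 'a \<Rightarrow> 'a"  (infixr \<open>*\<^sub>C\<close> 75)
    and adj :: "'a \<Rightarrow> 'a"  (\<open>(_\<^sup>\<star>)\<close> [1000] 999)
  assumes scaleR_scaleC: "r *\<^sub>R x = complex_of_real r *\<^sub>C x"
    and scaleC_add_right: "c *\<^sub>C (x + y) = c *\<^sub>C x + c *\<^sub>C y"
    and scaleC_add_left: "(c + d) *\<^sub>C x = c *\<^sub>C x + d *\<^sub>C x"
    and scaleC_scaleC: "c *\<^sub>C (d *\<^sub>C x) = (c * d) *\<^sub>C x"
    and scaleC_one: "1 *\<^sub>C x = x"
    and mult_scaleC_left: "(c *\<^sub>C x) * y = c *\<^sub>C (x * y)"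
    and mult_scaleC_right: "x * (c *\<^sub>C y) = c *\<^sub>C (x * y)"
    and norm_scaleC: "norm (c *\<^sub>C x) = cmod c * norm x"
    and adj_add: "(x + y)\<^sup>\<star> = x\<^sup>\<star> + y\<^sup>\<star>"
    and adj_scaleC: "(c *\<^sub>C x)\<^sup>\<star> = cnj c *\<^sub>C x\<^sup>\<star>"
    and adj_mult: "(x * y)\<^sup>\<star> = y\<^sup>\<star> * x\<^sup>\<star>"
    and adj_adj: "(x\<^sup>\<star>)\<^sup>\<star> = x"
    and norm_adj_mult: "norm (x\<^sup>\<star> * x) = (norm x)\<^sup>2"

instantiation complex :: cstar_algebra
begin
definition scaleC_complex :: "complex \<Rightarrow> complex \<Rightarrow> complex" where "scaleC_complex = (*)"
definition adj_complex :: "complex \<Rightarrow> complex" where "adj_complex = cnj"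
instance
  by standard (auto simp: scaleC_complex_def adj_complex_def algebra_simps scaleR_conv_of_real
      norm_mult power2_eq_square)
end

text \<open>Unital *-homomorphisms; as usual no continuity is required.\<close>

definition unital_star_hom :: "('a::cstar_algebra \<Rightarrow> 'b::cstar_algebra) \<Rightarrow> bool" where
  "unital_star_hom f \<longleftrightarrow>
     (\<forall>x y. f (x + y) = f x + f y) \<and> (\<forall>c x. f (c *\<^sub>C x) = c *\<^sub>C f x) \<and>
     (\<forall>x y. f (x * y) = f x * f y) \<and> (\<forall>x. f (x\<^sup>\<star>) = (f x)\<^sup>\<star>) \<and> f 1 = 1"

definition cstar_subalgebra :: "'a::cstar_algebra set \<Rightarrow> bool" where
  "cstar_subalgebra A \<longleftrightarrow> closed A \<and> 0 \<in> A \<and>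
     (\<forall>x\<in>A. \<forall>y\<in>A. x + y \<in> A) \<and> (\<forall>c. \<forall>x\<in>A. c *\<^sub>C x \<in> A) \<and>
     (\<forall>x\<in>A. \<forall>y\<in>A. x * y \<in> A) \<and> (\<forall>x\<in>A. x\<^sup>\<star> \<in> A)"

text \<open>The C*-subalgebra generated by a set.\<close>

definition cstar_generated :: "'a::cstar_algebra set \<Rightarrow> 'a set" where
  "cstar_generated X = cstar_subalgebra hull X"

section \<open>The free unital *-algebra on two generators\<close>

text \<open>Words in the letters \<open>u, u*, s, s*\<close> form the free monoid, written additively so that
  finitely supported functions on it carry the convolution product of
  \<^theory>\<open>HOL-Library.Poly_Mapping\<close>.\<close>

datatype letter = LU | LUadj | LS | LSadj

fun letter_adj :: "letter \<Rightarrow> letter" where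
  "letter_adj LU = LUadj"
| "letter_adj LUadj = LU"
| "letter_adj LS = LSadj"
| "letter_adj LSadj = LS"

lemma letter_adj_adj [simp]: "letter_adj (letter_adj l) = l"
  by (cases l) auto

datatype "word" = Word (letters: "letter list")

instantiation "word" :: monoid_add
begin
definition zero_word :: "word" where "0 = Word []"
definition plus_word :: "word \<Rightarrow> word \<Rightarrow> word" where "v + w = Word (letters v @ letters w)"
instance by standard (auto simp: zero_word_def plus_word_def)
end

lemma letters_0 [simp]: "letters 0 = []"
  and letters_plus [simp]: "letters (v + w) = letters v @ letters w"
  by (auto simp: zero_word_def plus_word_def)

definition word_adj :: "word \<Rightarrow> word" where
  "word_adj w = Word (rev (map letter_adj (letters w)))"

lemma word_adj_adj [simp]: "word_adj (word_adj w) = w"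
  by (cases w) (simp add: word_adj_def rev_map o_def)

lemma word_adj_add: "word_adj (v + w) = word_adj w + word_adj v"
  by (simp add: word_adj_def plus_word_def)

lemma word_adj_0 [simp]: "word_adj 0 = 0"
  by (simp add: word_adj_def zero_word_def)

type_synonym free = "word \<Rightarrow>\<^sub>0 complex"

definition free_scale :: "complex \<Rightarrow> free \<Rightarrow> free" where
  "free_scale c f = Poly_Mapping.single 0 c * f"

lift_definition free_adj :: "free \<Rightarrow> free" is "\<lambda>f w. cnj (f (word_adj w))"
proof -
  fix f :: "word \<Rightarrow> complex" assume "finite {x. f x \<noteq> 0}"
  moreover have "{x. cnj (f (word_adj x)) \<noteq> 0} = word_adj ` {x. f x \<noteq> 0}"
    by (auto simp: image_iff) (metis word_adj_adj)
  ultimately show "finite {x. cnj (f (word_adj x)) \<noteq> 0}" by simp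
qed

definition free_letter :: "letter \<Rightarrow> free" where
  "free_letter l = Poly_Mapping.single (Word [l]) 1"

abbreviation free_u :: free where "free_u \<equiv> free_letter LU"
abbreviation free_s :: free where "free_s \<equiv> free_letter LS"

lemma lookup_single_mult_0:
  "Poly_Mapping.lookup (Poly_Mapping.single 0 c * f) w = c * Poly_Mapping.lookup (f :: free) w"
  by (simp add: mult_map_scale_conv_mult[symmetric] Poly_Mapping.map.rep_eq when_def)

lemma lookup_free_scale [simp]: "Poly_Mapping.lookup (free_scale c f) w = c * Poly_Mapping.lookup f w"
  by (simp add: free_scale_def lookup_single_mult_0)

lemma free_scale_single [simp]:
  "free_scale c (Poly_Mapping.single w d) = Poly_Mapping.single w (c * d)"
  by (simp add: free_scale_def mult_single)

lemma free_induct [case_names add single]: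
  fixes P :: "free \<Rightarrow> bool"
  assumes add: "\<And>f g. P f \<Longrightarrow> P g \<Longrightarrow> P (f + g)"
    and single: "\<And>w c. P (Poly_Mapping.single w c)"
  shows "P f"
proof (induction f rule: update_induct)
  case const
  show ?case using single[of 0 0] by simp
next
  case (update f a b)
  have "Poly_Mapping.update a b f = f + Poly_Mapping.single a b"
    using update by (intro poly_mapping_eqI)
      (auto simp: lookup_update lookup_add lookup_single when_def in_keys_iff)
  then show ?case using add[OF update(3) single] by simp
qed

lemma free_scale_add: "free_scale c (f + g) = free_scale c f + free_scale c g"
  by (simp add: free_scale_def distrib_left)

lemma free_scale_diff: "free_scale c (f - g) = free_scale c f - free_scale c g"
  by (simp add: free_scale_def right_diff_distrib)

lemma free_scale_add_left: "free_scale (c + d) f = free_scale c f + free_scale d f"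
  by (rule poly_mapping_eqI) (simp add: lookup_add distrib_right)

lemma free_scale_scale: "free_scale c (free_scale d f) = free_scale (c * d) f"
  by (rule poly_mapping_eqI) simp

lemma free_scale_one [simp]: "free_scale 1 f = f"
  by (rule poly_mapping_eqI) simp

lemma free_scale_minus_one: "free_scale (-1) f = - f"
  by (rule poly_mapping_eqI) simp

lemma free_scale_mult_left: "free_scale c f * g = free_scale c (f * g)"
  by (simp add: free_scale_def mult.assoc)

lemma free_scale_mult_right: "f * free_scale c g = free_scale c (f * g)"
proof -
  have "f * Poly_Mapping.single 0 c = Poly_Mapping.single 0 c * f"
    by (induction f rule: free_induct) (simp_all add: distrib_left distrib_right mult_single mult.commute)
  then show ?thesis by (metis free_scale_def mult.assoc)
qed

lemma free_adj_single [simp]: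
  "free_adj (Poly_Mapping.single w c) = Poly_Mapping.single (word_adj w) (cnj c)"
proof (rule poly_mapping_eqI)
  fix v
  have "w = word_adj v \<longleftrightarrow> word_adj w = v" by (metis word_adj_adj)
  then show "Poly_Mapping.lookup (free_adj (Poly_Mapping.single w c)) v
      = Poly_Mapping.lookup (Poly_Mapping.single (word_adj w) (cnj c)) v"
    by (simp add: free_adj.rep_eq lookup_single when_def)
qed

lemma free_adj_add: "free_adj (f + g) = free_adj f + free_adj g"
  by (rule poly_mapping_eqI) (simp add: free_adj.rep_eq lookup_add)

lemma free_adj_diff: "free_adj (f - g) = free_adj f - free_adj g"
  by (rule poly_mapping_eqI) (simp add: free_adj.rep_eq lookup_minus)

lemma free_adj_adj [simp]: "free_adj (free_adj f) = f"
  by (rule poly_mapping_eqI) (simp add: free_adj.rep_eq)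

lemma free_adj_scale: "free_adj (free_scale c f) = free_scale (cnj c) (free_adj f)"
  by (rule poly_mapping_eqI) (simp add: free_adj.rep_eq)

lemma free_adj_mult: "free_adj (f * g) = free_adj g * free_adj f"
proof (induction f rule: free_induct)
  case (single v c)
  show ?case
    by (induction g rule: free_induct)
      (simp_all add: distrib_left distrib_right free_adj_add mult_single word_adj_add mult.commute)
qed (simp add: distrib_left distrib_right free_adj_add)

lemma free_adj_one [simp]: "free_adj 1 = 1"
  by (metis free_adj_single complex_cnj_one single_one word_adj_0)

lemma free_adj_letter [simp]: "free_adj (free_letter l) = free_letter (letter_adj l)"
  by (simp add: free_letter_def word_adj_def)

section \<open>The universal C*-seminorm\<close>

text \<open>The defining relations are \<open>r = 0\<close> for the following elements: \<open>u\<close> is a unitary,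
  \<open>s\<close> is an isometry, \<open>s u = u\<^sup>2 s\<close> and \<open>s s* + u s s* u* = 1\<close>.\<close>

definition Q2_relators :: "free set" where
  "Q2_relators =
    {free_adj free_u * free_u - 1,
     free_u * free_adj free_u - 1,
     free_adj free_s * free_s - 1,
     free_s * free_u - free_u * free_u * free_s,
     free_s * free_adj free_s + free_u * free_s * free_adj free_s * free_adj free_u - 1}"

text \<open>C*-seminorms on the free *-algebra that annihilate the relations. These are exactly the
  functions \<open>f \<mapsto> norm (\<pi> f)\<close> for \<open>\<pi>\<close> induced by a pair of elements of a (possibly zero)
  C*-algebra subject to the relations.\<close>

definition Q2_seminorm :: "(free \<Rightarrow> real) \<Rightarrow> bool" where
  "Q2_seminorm p \<longleftrightarrow>
     (\<forall>f. 0 \<le> p f) \<and>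
     (\<forall>f g. p (f + g) \<le> p f + p g) \<and>
     (\<forall>c f. p (free_scale c f) = cmod c * p f) \<and>
     (\<forall>f g. p (f * g) \<le> p f * p g) \<and>
     (\<forall>f. p (free_adj f * f) = (p f)\<^sup>2) \<and>
     (\<forall>r\<in>Q2_relators. p r = 0)"

definition Q2_norm :: "free \<Rightarrow> real" where
  "Q2_norm f = (SUP p\<in>Collect Q2_seminorm. p f)"

context
  fixes p assumes p: "Q2_seminorm p"
begin

lemma Q2_seminormD:
  "0 \<le> p f" "p (f + g) \<le> p f + p g" "p (free_scale c f) = cmod c * p f"
  "p (f * g) \<le> p f * p g" "p (free_adj f * f) = (p f)\<^sup>2" "r \<in> Q2_relators \<Longrightarrow> p r = 0"
  using p unfolding Q2_seminorm_def by blast+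

lemma Q2_seminorm_one: "p 1 \<le> 1"
proof -
  have "p 1 = (p 1)\<^sup>2" using Q2_seminormD(5)[of 1] by simp
  then show ?thesis by (auto simp: power2_eq_square)
qed

lemma Q2_seminorm_adj: "p (free_adj f) = p f"
proof -
  have le: "p g \<le> p (free_adj g)" for g
  proof (cases "p g = 0")
    case False
    have "p g * p g \<le> p (free_adj g) * p g"
      using Q2_seminormD(4)[of "free_adj g" g] Q2_seminormD(5)[of g] by (simp add: power2_eq_square)
    then show ?thesis using False Q2_seminormD(1)[of g] by (simp add: mult_le_cancel_right)
  qed (use Q2_seminormD(1) in simp)
  show ?thesis using le[of f] le[of "free_adj f"] by simp
qed

lemma Q2_seminorm_isometry:
  assumes "free_adj g * g - 1 \<in> Q2_relators"
  shows "p g \<le> 1"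
proof -
  have "p (free_adj g * g) \<le> p (free_adj g * g - 1) + p 1"
    using Q2_seminormD(2)[of "free_adj g * g - 1" 1] by simp
  then have "(p g)\<^sup>2 \<le> 1\<^sup>2" using Q2_seminormD(5,6) assms Q2_seminorm_one by simp
  then show ?thesis by (rule power2_le_imp_le) simp
qed

lemma Q2_seminorm_letter: "p (free_letter l) \<le> 1"
proof -
  have "p free_u \<le> 1" "p free_s \<le> 1"
    by (rule Q2_seminorm_isometry; simp add: Q2_relators_def)+
  then show ?thesis
    using Q2_seminorm_adj[of free_u] Q2_seminorm_adj[of free_s] by (cases l) auto
qed

lemma Q2_seminorm_word: "p (Poly_Mapping.single (Word ls) 1) \<le> 1"
proof (induction ls)
  case Nil
  then show ?case using Q2_seminorm_one by (simp flip: zero_word_def)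
next
  case (Cons l ls)
  have "Poly_Mapping.single (Word (l # ls)) 1 = free_letter l * Poly_Mapping.single (Word ls) 1"
    by (simp add: free_letter_def mult_single plus_word_def)
  then show ?case
    using Q2_seminormD(4)[of "free_letter l" "Poly_Mapping.single (Word ls) 1"]
      mult_mono[OF Q2_seminorm_letter[of l] Cons.IH] Q2_seminormD(1) by fastforce
qed

end

lemma Q2_seminorm_bounded: "\<exists>B. \<forall>p. Q2_seminorm p \<longrightarrow> p f \<le> B"
proof (induction f rule: free_induct)
  case (add f g)
  then obtain B C where "\<forall>p. Q2_seminorm p \<longrightarrow> p f \<le> B" "\<forall>p. Q2_seminorm p \<longrightarrow> p g \<le> C" by blast
  then have "\<forall>p. Q2_seminorm p \<longrightarrow> p (f + g) \<le> B + C"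
    by (meson Q2_seminormD(2) add_mono order_trans)
  then show ?case by blast
next
  case (single w c)
  have "p (Poly_Mapping.single w c) \<le> cmod c" if p: "Q2_seminorm p" for p
  proof -
    have "p (free_scale c (Poly_Mapping.single w 1)) \<le> cmod c * 1"
      unfolding Q2_seminormD(3)[OF p]
      by (rule mult_left_mono) (use Q2_seminorm_word[OF p, of "letters w"] in auto)
    then show ?thesis by simp
  qed
  then show ?case by blast
qed

lemma Q2_seminorm_zero: "Q2_seminorm (\<lambda>_. 0)"
  by (simp add: Q2_seminorm_def)

lemma Q2_seminorm_le_norm: "Q2_seminorm p \<Longrightarrow> p f \<le> Q2_norm f"
  unfolding Q2_norm_def using Q2_seminorm_bounded[of f]
  by (intro cSUP_upper) (auto simp: bdd_above_def)

lemma Q2_norm_least: "(\<And>p. Q2_seminorm p \<Longrightarrow> p f \<le> B) \<Longrightarrow> Q2_norm f \<le> B"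
  unfolding Q2_norm_def using Q2_seminorm_zero by (intro cSUP_least) auto

lemma Q2_seminorm_norm: "Q2_seminorm Q2_norm"
proof -
  have nonneg: "0 \<le> Q2_norm f" for f
    using Q2_seminorm_le_norm[OF Q2_seminorm_zero] by simp
  have scale_le: "Q2_norm (free_scale c f) \<le> cmod c * Q2_norm f" for c f
    by (rule Q2_norm_least) (simp add: Q2_seminormD(3) Q2_seminorm_le_norm mult_left_mono)
  have scale: "Q2_norm (free_scale c f) = cmod c * Q2_norm f" for c f
  proof (cases "c = 0")
    case True
    then show ?thesis using scale_le[of c f] nonneg[of "free_scale c f"] by simp
  next
    case False
    have "Q2_norm f \<le> cmod (inverse c) * Q2_norm (free_scale c f)"
      using scale_le[of "inverse c" "free_scale c f"] False by (simp add: free_scale_scale)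
    then have "cmod c * Q2_norm f \<le> cmod c * (cmod (inverse c) * Q2_norm (free_scale c f))"
      by (rule mult_left_mono) simp
    also have "\<dots> = Q2_norm (free_scale c f)" using False by (simp add: norm_inverse)
    finally show ?thesis using scale_le[of c f] by simp
  qed
  have cstar: "Q2_norm (free_adj f * f) = (Q2_norm f)\<^sup>2" for f
  proof (rule antisym)
    show "Q2_norm (free_adj f * f) \<le> (Q2_norm f)\<^sup>2"
      by (rule Q2_norm_least) (simp add: Q2_seminormD Q2_seminorm_le_norm power_mono)
    have "Q2_norm f \<le> sqrt (Q2_norm (free_adj f * f))"
      by (rule Q2_norm_least)
        (metis Q2_seminormD(5) Q2_seminorm_le_norm real_le_rsqrt)
    then show "(Q2_norm f)\<^sup>2 \<le> Q2_norm (free_adj f * f)"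
      using nonneg by (metis real_sqrt_le_iff real_sqrt_pow2 power_mono)
  qed
  have rel: "Q2_norm r = 0" if "r \<in> Q2_relators" for r
    by (rule antisym) (use that nonneg in \<open>auto intro!: Q2_norm_least simp: Q2_seminormD(6)\<close>)
  have add: "Q2_norm (f + g) \<le> Q2_norm f + Q2_norm g" for f g
    by (rule Q2_norm_least) (meson Q2_seminormD(2) Q2_seminorm_le_norm add_mono order_trans)
  have mult: "Q2_norm (f * g) \<le> Q2_norm f * Q2_norm g" for f g
    by (rule Q2_norm_least)
      (meson Q2_seminormD(1,4) Q2_seminorm_le_norm mult_mono nonneg order_trans)
  show ?thesis
    unfolding Q2_seminorm_def using nonneg scale cstar rel add mult by blast
qed

lemmas Q2_norm_nonneg [simp] = Q2_seminormD(1)[OF Q2_seminorm_norm]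
  and Q2_norm_add = Q2_seminormD(2)[OF Q2_seminorm_norm]
  and Q2_norm_scale = Q2_seminormD(3)[OF Q2_seminorm_norm]
  and Q2_norm_mult = Q2_seminormD(4)[OF Q2_seminorm_norm]
  and Q2_norm_cstar = Q2_seminormD(5)[OF Q2_seminorm_norm]
  and Q2_norm_relator = Q2_seminormD(6)[OF Q2_seminorm_norm]
  and Q2_norm_adj = Q2_seminorm_adj[OF Q2_seminorm_norm]


section \<open>Evaluation of the free *-algebra\<close>

definition lin_ext :: "(word \<Rightarrow> 'a::cstar_algebra) \<Rightarrow> free \<Rightarrow> 'a" where
  "lin_ext g f = (\<Sum>w\<in>Poly_Mapping.keys f. Poly_Mapping.lookup f w *\<^sub>C g w)"

lemma scaleC_zero_left [simp]: "0 *\<^sub>C x = 0"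
  using scaleC_add_left[of 0 0 x] by simp

lemma scaleC_zero_right [simp]: "c *\<^sub>C 0 = 0"
  using scaleC_add_right[of c 0 0] by simp

lemma scaleC_minus_one: "(-1) *\<^sub>C x = - x"
proof -
  have "(1 + (-1)) *\<^sub>C x = x + (-1) *\<^sub>C x" by (simp only: scaleC_add_left scaleC_one)
  then show ?thesis by (simp add: eq_neg_iff_add_eq_0 add.commute)
qed

lemma adj_zero [simp]: "(0 :: 'a::cstar_algebra)\<^sup>\<star> = 0"
  using adj_add[of "0::'a" 0] by simp

lemma adj_one [simp]: "(1 :: 'a::cstar_algebra)\<^sup>\<star> = 1"
  by (metis adj_adj adj_mult mult.right_neutral mult.left_neutral)

lemma lin_ext_superset:
  assumes "finite A" "Poly_Mapping.keys f \<subseteq> A"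
  shows "lin_ext g f = (\<Sum>w\<in>A. Poly_Mapping.lookup f w *\<^sub>C g w)"
  unfolding lin_ext_def using assms by (intro sum.mono_neutral_left) (auto simp: in_keys_iff)

lemma lin_ext_single [simp]: "lin_ext g (Poly_Mapping.single w c) = c *\<^sub>C g w"
  by (subst lin_ext_superset[of "{w}"]) auto

lemma lin_ext_add: "lin_ext g (f + h) = lin_ext g f + lin_ext g h"
proof -
  let ?A = "Poly_Mapping.keys f \<union> Poly_Mapping.keys h"
  have "Poly_Mapping.keys (f + h) \<subseteq> ?A" by (rule Poly_Mapping.keys_add)
  then show ?thesis
    by (simp add: lin_ext_superset[of ?A] lookup_add scaleC_add_left sum.distrib)
qed

lemma lin_ext_scale: "lin_ext g (free_scale c f) = c *\<^sub>C lin_ext g f"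
  by (induction f rule: free_induct)
    (simp_all add: free_scale_add lin_ext_add scaleC_add_right scaleC_scaleC)

lemma lin_ext_minus: "lin_ext g (- f) = - lin_ext g f"
  by (metis free_scale_minus_one lin_ext_scale scaleC_minus_one)

lemma lin_ext_diff: "lin_ext g (f - h) = lin_ext g f - lin_ext g h"
  by (metis lin_ext_add lin_ext_minus diff_conv_add_uminus)

section \<open>The canonical representation\<close>

text \<open>The representation \<open>U e\<^sub>k = e\<^sub>k\<^sub>+\<^sub>1\<close>, \<open>S\<^sub>2 e\<^sub>k = e\<^sub>2\<^sub>k\<close> on the
  finitely supported vectors of \<open>\<ell>\<^sup>2(\<int>)\<close> shows that the universal seminorm of \<open>1\<close> is \<open>1\<close>.\<close>

fun letter_op :: "letter \<Rightarrow> (int \<Rightarrow> complex) \<Rightarrow> int \<Rightarrow> complex" where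
  "letter_op LU x = (\<lambda>j. x (j - 1))"
| "letter_op LUadj x = (\<lambda>j. x (j + 1))"
| "letter_op LS x = (\<lambda>j. if even j then x (j div 2) else 0)"
| "letter_op LSadj x = (\<lambda>j. x (2 * j))"

definition word_op :: "word \<Rightarrow> (int \<Rightarrow> complex) \<Rightarrow> int \<Rightarrow> complex" where
  "word_op w = foldr letter_op (letters w)"

definition rep :: "free \<Rightarrow> (int \<Rightarrow> complex) \<Rightarrow> int \<Rightarrow> complex" where
  "rep f x j = lin_ext (\<lambda>w. word_op w x j) f"

definition fin_supp :: "(int \<Rightarrow> complex) \<Rightarrow> bool" where
  "fin_supp x \<longleftrightarrow> finite {j. x j \<noteq> 0}"

definition ip :: "(int \<Rightarrow> complex) \<Rightarrow> (int \<Rightarrow> complex) \<Rightarrow> complex" where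
  "ip x y = (\<Sum>j\<in>{j. x j * cnj (y j) \<noteq> 0}. x j * cnj (y j))"

definition nrm :: "(int \<Rightarrow> complex) \<Rightarrow> real" where
  "nrm x = L2_set (\<lambda>j. cmod (x j)) {j. x j \<noteq> 0}"

lemma rep_add: "rep (f + g) x = (\<lambda>j. rep f x j + rep g x j)"
  and rep_diff: "rep (f - g) x = (\<lambda>j. rep f x j - rep g x j)"
  and rep_scale: "rep (free_scale c f) x = (\<lambda>j. c * rep f x j)"
  and rep_single: "rep (Poly_Mapping.single w c) x = (\<lambda>j. c * word_op w x j)"
  by (auto simp: rep_def lin_ext_add lin_ext_diff lin_ext_scale scaleC_complex_def)

lemma word_op_plus: "word_op (v + w) x = word_op v (word_op w x)"
  by (simp add: word_op_def)

lemma letter_op_add: "letter_op l (\<lambda>j. x j + y j) = (\<lambda>j. letter_op l x j + letter_op l y j)"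
  and letter_op_scale: "letter_op l (\<lambda>j. c * x j) = (\<lambda>j. c * letter_op l x j)"
  by (cases l; auto)+

lemma word_op_add: "word_op w (\<lambda>j. x j + y j) = (\<lambda>j. word_op w x j + word_op w y j)"
  and word_op_scale: "word_op w (\<lambda>j. c * x j) = (\<lambda>j. c * word_op w x j)"
proof -
  have "foldr letter_op ls (\<lambda>j. x j + y j) = (\<lambda>j. foldr letter_op ls x j + foldr letter_op ls y j)"
    "foldr letter_op ls (\<lambda>j. c * x j) = (\<lambda>j. c * foldr letter_op ls x j)" for ls
    by (induction ls) (simp_all add: letter_op_add letter_op_scale)
  then show "word_op w (\<lambda>j. x j + y j) = (\<lambda>j. word_op w x j + word_op w y j)"
    "word_op w (\<lambda>j. c * x j) = (\<lambda>j. c * word_op w x j)"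
    by (simp_all add: word_op_def)
qed

lemma rep_add_right: "rep f (\<lambda>j. x j + y j) = (\<lambda>j. rep f x j + rep f y j)"
  by (induction f rule: free_induct)
    (simp_all add: rep_add rep_single word_op_add distrib_left add_ac)

lemma rep_scale_right: "rep f (\<lambda>j. c * x j) = (\<lambda>j. c * rep f x j)"
  by (induction f rule: free_induct)
    (simp_all add: rep_add rep_single word_op_scale distrib_left mult_ac)

lemma rep_mult: "rep (f * g) x = rep f (rep g x)"
proof (induction f rule: free_induct)
  case (single v c)
  show ?case
    by (induction g rule: free_induct)
      (simp_all add: distrib_left rep_add rep_add_right rep_scale_right mult_single rep_single
        word_op_plus word_op_scale mult_ac)
qed (simp add: distrib_right rep_add)

lemma rep_letter: "rep (free_letter l) x = letter_op l x"
  by (simp add: free_letter_def rep_single word_op_def)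

lemma rep_one: "rep 1 x = x"
  using rep_single[of 0 1 x] by (simp add: word_op_def)

lemma fin_supp_letter: "fin_supp x \<Longrightarrow> fin_supp (letter_op l x)"
proof (cases l)
  case LU
  assume "fin_supp x"
  moreover have "{j. x (j - 1) \<noteq> 0} = (\<lambda>j. j + 1) ` {j. x j \<noteq> 0}"
    by (auto simp: image_iff) (metis diff_add_cancel)
  ultimately show ?thesis using LU by (simp add: fin_supp_def)
next
  case LUadj
  assume "fin_supp x"
  moreover have "{j. x (j + 1) \<noteq> 0} = (\<lambda>j. j - 1) ` {j. x j \<noteq> 0}"
    by (auto simp: image_iff) (metis add_diff_cancel_right')
  ultimately show ?thesis using LUadj by (simp add: fin_supp_def)
next
  case LS
  assume "fin_supp x"
  then have "finite ((\<lambda>j. 2 * j) ` {j. x j \<noteq> 0})" by (simp add: fin_supp_def)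
  moreover have "{j. letter_op l x j \<noteq> 0} \<subseteq> (\<lambda>j. 2 * j) ` {j. x j \<noteq> 0}" using LS by auto
  ultimately show ?thesis unfolding fin_supp_def by (rule finite_subset[rotated])
next
  case LSadj
  assume "fin_supp x"
  then have "finite ((\<lambda>j. j div 2) ` {j. x j \<noteq> 0})" by (simp add: fin_supp_def)
  moreover have "{j. letter_op l x j \<noteq> 0} \<subseteq> (\<lambda>j. j div 2) ` {j. x j \<noteq> 0}"
    using LSadj by (auto simp: image_iff) (metis nonzero_mult_div_cancel_left zero_neq_numeral)
  ultimately show ?thesis unfolding fin_supp_def by (rule finite_subset[rotated])
qed

lemma fin_supp_add: "fin_supp x \<Longrightarrow> fin_supp y \<Longrightarrow> fin_supp (\<lambda>j. x j + y j)"
  unfolding fin_supp_def by (rule finite_subset[of _ "{j. x j \<noteq> 0} \<union> {j. y j \<noteq> 0}"]) auto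

lemma fin_supp_scale: "fin_supp x \<Longrightarrow> fin_supp (\<lambda>j. c * x j)"
  unfolding fin_supp_def by (rule finite_subset[of _ "{j. x j \<noteq> 0}"]) auto

lemma fin_supp_word: "fin_supp x \<Longrightarrow> fin_supp (word_op w x)"
proof -
  assume "fin_supp x"
  then have "fin_supp (foldr letter_op ls x)" for ls
    by (induction ls) (simp_all add: fin_supp_letter)
  then show ?thesis by (simp add: word_op_def)
qed

lemma fin_supp_rep: "fin_supp x \<Longrightarrow> fin_supp (rep f x)"
  by (induction f rule: free_induct)
    (simp_all add: rep_add rep_single fin_supp_add fin_supp_scale fin_supp_word)

lemma ip_eq_sum:
  assumes "finite A" "\<And>j. x j \<noteq> 0 \<Longrightarrow> y j \<noteq> 0 \<Longrightarrow> j \<in> A"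
  shows "ip x y = (\<Sum>j\<in>A. x j * cnj (y j))"
  unfolding ip_def using assms by (intro sum.mono_neutral_left) auto

lemma nrm_eq_L2_set:
  assumes "finite A" "\<And>j. x j \<noteq> 0 \<Longrightarrow> j \<in> A"
  shows "nrm x = L2_set (\<lambda>j. cmod (x j)) A"
  unfolding nrm_def L2_set_def using assms
  by (intro arg_cong[where f = sqrt] sum.mono_neutral_left) auto

lemma ip_letter: "ip (letter_op l x) y = ip x (letter_op (letter_adj l) y)"
proof (cases l)
  case LU
  show ?thesis unfolding LU ip_def
    by (rule sum.reindex_bij_witness[of _ "\<lambda>j. j + 1" "\<lambda>j. j - 1"]) auto
next
  case LUadj
  show ?thesis unfolding LUadj ip_def
    by (rule sum.reindex_bij_witness[of _ "\<lambda>j. j - 1" "\<lambda>j. j + 1"]) auto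
next
  case LS
  show ?thesis unfolding LS ip_def
    by (rule sum.reindex_bij_witness[of _ "\<lambda>j. 2 * j" "\<lambda>j. j div 2"]) (auto split: if_splits)
next
  case LSadj
  show ?thesis unfolding LSadj ip_def
    by (rule sum.reindex_bij_witness[of _ "\<lambda>j. j div 2" "\<lambda>j. 2 * j"]) (auto split: if_splits)
qed

lemma ip_word: "ip (word_op w x) y = ip x (word_op (word_adj w) y)"
proof -
  have "ip (foldr letter_op ls x) y = ip x (foldr letter_op (rev (map letter_adj ls)) y)" for ls
    by (induction ls arbitrary: y) (simp_all add: ip_letter)
  then show ?thesis by (simp add: word_op_def word_adj_def)
qed

lemma ip_add_left:
  assumes "fin_supp x" "fin_supp y"
  shows "ip (\<lambda>j. x j + y j) z = ip x z + ip y z"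
proof -
  let ?A = "{j. x j \<noteq> 0} \<union> {j. y j \<noteq> 0}"
  have "finite ?A" using assms by (simp add: fin_supp_def)
  then show ?thesis
    by (subst (1 2 3) ip_eq_sum[of ?A]) (auto simp: distrib_right sum.distrib)
qed

lemma ip_commute: "ip y x = cnj (ip x y)"
  by (simp add: ip_def cnj_sum mult.commute disj_commute conj_commute)

lemma ip_add_right:
  assumes "fin_supp y" "fin_supp z"
  shows "ip x (\<lambda>j. y j + z j) = ip x y + ip x z"
  by (subst (1 2 3) ip_commute) (simp add: ip_add_left[OF assms])

lemma ip_scale_left: "ip (\<lambda>j. c * x j) y = c * ip x y"
  by (cases "c = 0") (simp_all add: ip_def sum_distrib_left mult_ac)

lemma ip_scale_right: "ip x (\<lambda>j. c * y j) = cnj c * ip x y"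
  by (subst (1 2) ip_commute) (simp add: ip_scale_left)

lemma ip_rep:
  assumes "fin_supp x" "fin_supp y"
  shows "ip (rep f x) y = ip x (rep (free_adj f) y)"
  by (induction f rule: free_induct)
    (simp_all add: assms rep_add rep_single free_adj_add ip_add_left ip_add_right fin_supp_rep
      ip_scale_left ip_scale_right ip_word)

lemma nrm_nonneg [simp]: "0 \<le> nrm x"
  by (simp add: nrm_def)

lemma nrm_power2: "(nrm x)\<^sup>2 = Re (ip x x)"
proof -
  have "{j. x j * cnj (x j) \<noteq> 0} = {j. x j \<noteq> 0}" by simp
  then show ?thesis
    by (simp add: nrm_def L2_set_def ip_def sum_nonneg flip: of_real_sum complex_norm_square)
qed

lemma nrm_triangle:
  assumes "fin_supp x" "fin_supp y"
  shows "nrm (\<lambda>j. x j + y j) \<le> nrm x + nrm y"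
proof -
  let ?A = "{j. x j \<noteq> 0} \<union> {j. y j \<noteq> 0}"
  have A: "finite ?A" using assms by (simp add: fin_supp_def)
  have "nrm (\<lambda>j. x j + y j) = L2_set (\<lambda>j. cmod (x j + y j)) ?A"
    by (rule nrm_eq_L2_set[OF A]) auto
  also have "\<dots> \<le> L2_set (\<lambda>j. cmod (x j) + cmod (y j)) ?A"
    by (rule L2_set_mono) (auto simp: norm_triangle_ineq)
  also have "\<dots> \<le> L2_set (\<lambda>j. cmod (x j)) ?A + L2_set (\<lambda>j. cmod (y j)) ?A"
    by (rule L2_set_triangle_ineq)
  also have "\<dots> = nrm x + nrm y"
    by (subst (1 2) nrm_eq_L2_set[OF A]) auto
  finally show ?thesis .
qed

lemma nrm_scale: "nrm (\<lambda>j. c * x j) = cmod c * nrm x"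
proof (cases "c = 0")
  case False
  then show ?thesis by (simp add: nrm_def norm_mult L2_set_right_distrib)
qed (simp add: nrm_def)

lemma ip_Cauchy_Schwarz:
  assumes "fin_supp x" "fin_supp y"
  shows "cmod (ip x y) \<le> nrm x * nrm y"
proof -
  let ?A = "{j. x j \<noteq> 0} \<union> {j. y j \<noteq> 0}"
  have A: "finite ?A" using assms by (simp add: fin_supp_def)
  have "cmod (ip x y) = cmod (\<Sum>j\<in>?A. x j * cnj (y j))"
    by (subst ip_eq_sum[OF A]) auto
  also have "\<dots> \<le> (\<Sum>j\<in>?A. cmod (x j) * cmod (y j))"
    by (rule order_trans[OF norm_sum]) (simp add: norm_mult)
  also have "\<dots> \<le> L2_set (\<lambda>j. cmod (x j)) ?A * L2_set (\<lambda>j. cmod (y j)) ?A"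
    using L2_set_mult_ineq[of "\<lambda>j. cmod (x j)" "\<lambda>j. cmod (y j)" ?A] by simp
  also have "\<dots> = nrm x * nrm y"
    by (subst (1 2) nrm_eq_L2_set[OF A]) auto
  finally show ?thesis .
qed

lemma nrm_letter:
  assumes "fin_supp x"
  shows "nrm (letter_op l x) \<le> nrm x"
proof -
  have isom: "nrm (letter_op l y) = nrm y" if "l \<noteq> LSadj" for l y
  proof -
    have "ip (letter_op l y) (letter_op l y) = ip y (letter_op (letter_adj l) (letter_op l y))"
      by (rule ip_letter)
    also have "letter_op (letter_adj l) (letter_op l y) = y" using that by (cases l) auto
    finally have "(nrm (letter_op l y))\<^sup>2 = (nrm y)\<^sup>2" by (simp add: nrm_power2)
    then show ?thesis by simp
  qed
  show ?thesis
  proof (cases "l = LSadj")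
    case True
    have "(nrm (letter_op l x))\<^sup>2 = Re (ip (letter_op l x) (letter_op l x))" by (rule nrm_power2)
    also have "\<dots> = Re (ip x (letter_op LS (letter_op l x)))"
      using True ip_letter[of l x "letter_op l x"] by simp
    also have "\<dots> \<le> nrm x * nrm (letter_op LS (letter_op l x))"
      by (rule order_trans[OF complex_Re_le_cmod ip_Cauchy_Schwarz])
        (intro assms fin_supp_letter)+
    also have "\<dots> = nrm x * nrm (letter_op l x)" by (subst isom) auto
    finally have "nrm (letter_op l x) * nrm (letter_op l x) \<le> nrm x * nrm (letter_op l x)"
      by (simp add: power2_eq_square)
    then show ?thesis
      by (cases "nrm (letter_op l x) = 0") (auto simp: mult_le_cancel_right less_le)
  qed (simp add: isom)
qed

lemma nrm_word:
  assumes "fin_supp x"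
  shows "nrm (word_op w x) \<le> nrm x"
proof -
  have "fin_supp (foldr letter_op ls x) \<and> nrm (foldr letter_op ls x) \<le> nrm x" for ls
  proof (induction ls)
    case (Cons l ls)
    then show ?case
      using nrm_letter[of "foldr letter_op ls x" l] fin_supp_letter by (auto intro: order_trans)
  qed (simp add: assms)
  then show ?thesis by (simp add: word_op_def)
qed

definition rep_bounds :: "free \<Rightarrow> real set" where
  "rep_bounds f = {B. 0 \<le> B \<and> (\<forall>x. fin_supp x \<longrightarrow> nrm (rep f x) \<le> B * nrm x)}"

definition rep_norm :: "free \<Rightarrow> real" where
  "rep_norm f = Inf (rep_bounds f)"

lemma rep_bounds_nonempty: "\<exists>B. B \<in> rep_bounds f"
proof (induction f rule: free_induct)
  case (add f g)
  then obtain B C where B: "B \<in> rep_bounds f" and C: "C \<in> rep_bounds g" by blast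
  have "nrm (rep (f + g) x) \<le> (B + C) * nrm x" if x: "fin_supp x" for x
  proof -
    have "nrm (rep f x) \<le> B * nrm x" "nrm (rep g x) \<le> C * nrm x"
      using B C x by (auto simp: rep_bounds_def)
    then show ?thesis
      using nrm_triangle[OF fin_supp_rep[OF x, of f] fin_supp_rep[OF x, of g]]
      by (simp add: rep_add distrib_right)
  qed
  then have "B + C \<in> rep_bounds (f + g)" using B C by (auto simp: rep_bounds_def)
  then show ?case ..
next
  case (single w c)
  have "cmod c \<in> rep_bounds (Poly_Mapping.single w c)"
    by (auto simp: rep_bounds_def rep_single nrm_scale nrm_word mult_left_mono)
  then show ?case ..
qed

lemma rep_norm_le:
  assumes "0 \<le> B" "\<And>x. fin_supp x \<Longrightarrow> nrm (rep f x) \<le> B * nrm x"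
  shows "rep_norm f \<le> B"
  unfolding rep_norm_def
  by (rule cInf_lower) (use assms in \<open>auto simp: rep_bounds_def intro!: bdd_belowI[of _ 0]\<close>)

lemma rep_norm_nonneg: "0 \<le> rep_norm f"
  unfolding rep_norm_def using rep_bounds_nonempty[of f]
  by (intro cInf_greatest) (auto simp: rep_bounds_def)

lemma nrm_rep:
  assumes "fin_supp x"
  shows "nrm (rep f x) \<le> rep_norm f * nrm x"
proof (cases "nrm x = 0")
  case True
  then show ?thesis using rep_bounds_nonempty[of f] assms by (fastforce simp: rep_bounds_def)
next
  case False
  then have pos: "0 < nrm x" by (simp add: less_le)
  have "nrm (rep f x) / nrm x \<le> rep_norm f"
    unfolding rep_norm_def using rep_bounds_nonempty[of f] assms pos
    by (intro cInf_greatest) (auto simp: rep_bounds_def pos_divide_le_eq)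
  then show ?thesis using pos by (simp add: pos_divide_le_eq)
qed

lemma Q2_seminorm_rep_norm: "Q2_seminorm rep_norm"
proof -
  have add: "rep_norm (f + g) \<le> rep_norm f + rep_norm g" for f g
  proof (rule rep_norm_le)
    fix x assume x: "fin_supp x"
    show "nrm (rep (f + g) x) \<le> (rep_norm f + rep_norm g) * nrm x"
      using nrm_triangle[OF fin_supp_rep[OF x, of f] fin_supp_rep[OF x, of g]]
        nrm_rep[OF x, of f] nrm_rep[OF x, of g]
      by (simp add: rep_add distrib_right)
  qed (simp add: rep_norm_nonneg)
  have scale_le: "rep_norm (free_scale c f) \<le> cmod c * rep_norm f" for c f
    by (rule rep_norm_le)
      (simp_all add: rep_norm_nonneg rep_scale nrm_scale mult.assoc mult_left_mono nrm_rep)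
  have scale: "rep_norm (free_scale c f) = cmod c * rep_norm f" for c f
  proof (cases "c = 0")
    case True
    then show ?thesis using scale_le[of c f] rep_norm_nonneg[of "free_scale c f"] by simp
  next
    case False
    have "rep_norm f \<le> cmod (inverse c) * rep_norm (free_scale c f)"
      using scale_le[of "inverse c" "free_scale c f"] False by (simp add: free_scale_scale)
    then have "cmod c * rep_norm f \<le> cmod c * (cmod (inverse c) * rep_norm (free_scale c f))"
      by (rule mult_left_mono) simp
    also have "\<dots> = rep_norm (free_scale c f)" using False by (simp add: norm_inverse)
    finally show ?thesis using scale_le[of c f] by simp
  qed
  have mult: "rep_norm (f * g) \<le> rep_norm f * rep_norm g" for f g
  proof (rule rep_norm_le)
    fix x assume x: "fin_supp x"
    have "nrm (rep (f * g) x) \<le> rep_norm f * nrm (rep g x)"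
      by (simp add: rep_mult nrm_rep fin_supp_rep x)
    also have "\<dots> \<le> rep_norm f * (rep_norm g * nrm x)"
      by (intro mult_left_mono nrm_rep x rep_norm_nonneg)
    finally show "nrm (rep (f * g) x) \<le> rep_norm f * rep_norm g * nrm x" by (simp add: mult.assoc)
  qed (simp add: rep_norm_nonneg)
  have le: "(rep_norm f)\<^sup>2 \<le> rep_norm (free_adj f * f)" for f
  proof -
    have "rep_norm f \<le> sqrt (rep_norm (free_adj f * f))"
    proof (rule rep_norm_le)
      fix x assume x: "fin_supp x"
      have "(nrm (rep f x))\<^sup>2 = Re (ip x (rep (free_adj f * f) x))"
        by (simp add: nrm_power2 ip_rep x fin_supp_rep rep_mult)
      also have "\<dots> \<le> nrm x * nrm (rep (free_adj f * f) x)"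
        by (rule order_trans[OF complex_Re_le_cmod ip_Cauchy_Schwarz]) (intro x fin_supp_rep)+
      also have "\<dots> \<le> nrm x * (rep_norm (free_adj f * f) * nrm x)"
        by (intro mult_left_mono nrm_rep x) simp
      also have "\<dots> = (sqrt (rep_norm (free_adj f * f)) * nrm x)\<^sup>2"
        by (simp add: power_mult_distrib rep_norm_nonneg power2_eq_square[of "nrm x"])
      finally show "nrm (rep f x) \<le> sqrt (rep_norm (free_adj f * f)) * nrm x"
        by (rule power2_le_imp_le) (simp add: rep_norm_nonneg)
    qed (simp add: rep_norm_nonneg)
    then have "(rep_norm f)\<^sup>2 \<le> (sqrt (rep_norm (free_adj f * f)))\<^sup>2"
      using rep_norm_nonneg by (intro power_mono)
    then show ?thesis by (simp add: rep_norm_nonneg)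
  qed
  have adj_le: "rep_norm f \<le> rep_norm (free_adj f)" for f
  proof (cases "rep_norm f = 0")
    case False
    then have "0 < rep_norm f" using rep_norm_nonneg[of f] by simp
    moreover have "rep_norm f * rep_norm f \<le> rep_norm (free_adj f) * rep_norm f"
      using le[of f] mult[of "free_adj f" f] by (simp add: power2_eq_square)
    ultimately show ?thesis by simp
  qed (simp add: rep_norm_nonneg)
  have cstar: "rep_norm (free_adj f * f) = (rep_norm f)\<^sup>2" for f
    using le[of f] mult[of "free_adj f" f] adj_le[of f] adj_le[of "free_adj f"]
    by (simp add: power2_eq_square)
  have rel: "rep_norm r = 0" if "r \<in> Q2_relators" for r
  proof -
    have "rep r x = (\<lambda>_. 0)" for x
      using that unfolding Q2_relators_def
      by (auto simp: rep_diff rep_add rep_mult rep_one rep_letter fun_eq_iff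
          elim!: evenE oddE)
    then have "rep_norm r \<le> 0" by (intro rep_norm_le) (simp_all add: nrm_def)
    then show ?thesis using rep_norm_nonneg[of r] by simp
  qed
  show ?thesis
    unfolding Q2_seminorm_def using rep_norm_nonneg add scale mult cstar rel by blast
qed

lemma Q2_norm_one [simp]: "Q2_norm 1 = 1"
proof (rule antisym)
  show "Q2_norm 1 \<le> 1" by (rule Q2_seminorm_one[OF Q2_seminorm_norm])
  let ?e = "\<lambda>j::int. if j = 0 then 1 else 0 :: complex"
  have "nrm ?e = 1" by (simp add: nrm_def L2_set_def)
  moreover have "fin_supp ?e" by (simp add: fin_supp_def)
  ultimately have "1 \<le> rep_norm 1" using nrm_rep[of ?e 1] by (simp add: rep_one)
  then show "1 \<le> Q2_norm 1"
    using Q2_seminorm_le_norm[OF Q2_seminorm_rep_norm, of 1] by simp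
qed

section \<open>The 2-adic ring C*-algebra\<close>

text \<open>The completion of the free *-algebra for the universal C*-seminorm: Cauchy sequences
  modulo null sequences.\<close>

lemma null_seq_le:
  fixes f :: "nat \<Rightarrow> 'a::real_normed_vector"
  assumes "g \<longlonglongrightarrow> 0" "\<And>n. norm (f n) \<le> g n"
  shows "f \<longlonglongrightarrow> 0"
  by (rule Lim_null_comparison[OF always_eventually assms(1)]) (simp add: assms(2))

lemma Q2_norm_zero [simp]: "Q2_norm 0 = 0"
  using Q2_norm_scale[of 0 0] by (simp add: free_scale_def)

lemma Q2_norm_minus [simp]: "Q2_norm (- f) = Q2_norm f"
  using Q2_norm_scale[of "-1" f] by (simp add: free_scale_minus_one)

lemma Q2_norm_diff_commute: "Q2_norm (f - g) = Q2_norm (g - f)"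
  using Q2_norm_minus[of "f - g"] by simp

lemma Q2_norm_triangle: "Q2_norm (f - h) \<le> Q2_norm (f - g) + Q2_norm (g - h)"
  using Q2_norm_add[of "f - g" "g - h"] by simp

lemma Q2_norm_abs_diff: "\<bar>Q2_norm f - Q2_norm g\<bar> \<le> Q2_norm (f - g)"
  using Q2_norm_add[of "f - g" g] Q2_norm_add[of "g - f" f] Q2_norm_diff_commute[of f g] by simp

lemma Q2_norm_diff_add: "Q2_norm (f + g - (h + k)) \<le> Q2_norm (f - h) + Q2_norm (g - k)"
  using Q2_norm_add[of "f - h" "g - k"] by (simp add: algebra_simps)

lemma Q2_norm_diff_mult:
  "Q2_norm (f * g - h * k) \<le> Q2_norm f * Q2_norm (g - k) + Q2_norm (f - h) * Q2_norm k"
proof -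
  have "f * g - h * k = f * (g - k) + (f - h) * k" by (simp add: algebra_simps)
  then show ?thesis
    using Q2_norm_add[of "f * (g - k)" "(f - h) * k"] Q2_norm_mult[of f "g - k"]
      Q2_norm_mult[of "f - h" k] by simp
qed

definition Q2_Cauchy :: "(nat \<Rightarrow> free) \<Rightarrow> bool" where
  "Q2_Cauchy X \<longleftrightarrow> (\<forall>e>0. \<exists>N. \<forall>m\<ge>N. \<forall>n\<ge>N. Q2_norm (X m - X n) < e)"

definition Q2_rel :: "(nat \<Rightarrow> free) \<Rightarrow> (nat \<Rightarrow> free) \<Rightarrow> bool" where
  "Q2_rel X Y \<longleftrightarrow> Q2_Cauchy X \<and> Q2_Cauchy Y \<and> (\<lambda>n. Q2_norm (X n - Y n)) \<longlonglongrightarrow> 0"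

lemma Q2_CauchyD:
  assumes "Q2_Cauchy X" "0 < e"
  obtains N where "\<And>m n. m \<ge> N \<Longrightarrow> n \<ge> N \<Longrightarrow> Q2_norm (X m - X n) < e"
  using assms unfolding Q2_Cauchy_def by blast

lemma Q2_Cauchy_const [simp]: "Q2_Cauchy (\<lambda>_. f)"
  by (simp add: Q2_Cauchy_def)

lemma Q2_rel_refl: "Q2_Cauchy X \<Longrightarrow> Q2_rel X X"
  by (simp add: Q2_rel_def)

lemma part_equivp_Q2_rel: "part_equivp Q2_rel"
proof (rule part_equivpI)
  show "\<exists>X. Q2_rel X X" using Q2_rel_refl[OF Q2_Cauchy_const] by blast
  show "symp Q2_rel"
  proof (rule sympI)
    fix X Y assume "Q2_rel X Y"
    moreover have "(\<lambda>n. Q2_norm (Y n - X n)) = (\<lambda>n. Q2_norm (X n - Y n))"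
      by (rule ext) (rule Q2_norm_diff_commute)
    ultimately show "Q2_rel Y X" by (simp only: Q2_rel_def simp_thms)
  qed
  show "transp Q2_rel"
  proof (rule transpI)
    fix X Y Z assume XY: "Q2_rel X Y" and YZ: "Q2_rel Y Z"
    have "(\<lambda>n. Q2_norm (X n - Y n) + Q2_norm (Y n - Z n)) \<longlonglongrightarrow> 0"
      using XY YZ by (intro tendsto_add_zero) (simp_all add: Q2_rel_def)
    then have "(\<lambda>n. Q2_norm (X n - Z n)) \<longlonglongrightarrow> 0"
      by (rule null_seq_le) (simp add: Q2_norm_triangle)
    then show "Q2_rel X Z" using XY YZ by (simp add: Q2_rel_def)
  qed
qed

quotient_type Q2 = "nat \<Rightarrow> free" / partial: Q2_rel
  by (rule part_equivp_Q2_rel)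

lemma Q2_Cauchy_lipschitz:
  assumes "Q2_Cauchy X" "\<And>m n. Q2_norm (Y m - Y n) \<le> B * Q2_norm (X m - X n)"
  shows "Q2_Cauchy Y"
  unfolding Q2_Cauchy_def
proof (intro allI impI)
  fix e :: real assume e: "0 < e"
  then have "0 < e / (\<bar>B\<bar> + 1)" by (simp add: add_nonneg_pos)
  then obtain N where N: "\<And>m n. m \<ge> N \<Longrightarrow> n \<ge> N \<Longrightarrow> Q2_norm (X m - X n) < e / (\<bar>B\<bar> + 1)"
    using assms(1) unfolding Q2_Cauchy_def by blast
  have "Q2_norm (Y m - Y n) < e" if mn: "m \<ge> N" "n \<ge> N" for m n
  proof -
    have "Q2_norm (Y m - Y n) \<le> (\<bar>B\<bar> + 1) * Q2_norm (X m - X n)"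
      by (rule order_trans[OF assms(2)]) (rule mult_right_mono, auto)
    also have "\<dots> < (\<bar>B\<bar> + 1) * (e / (\<bar>B\<bar> + 1))"
      using N[OF mn] by (intro mult_strict_left_mono) auto
    also have "\<dots> = e" by (simp add: add_nonneg_eq_0_iff)
    finally show ?thesis .
  qed
  then show "\<exists>N. \<forall>m\<ge>N. \<forall>n\<ge>N. Q2_norm (Y m - Y n) < e" by blast
qed

lemma Q2_norm_minus_diff: "Q2_norm (- f - (- g)) = Q2_norm (f - g)"
  by (simp only: minus_diff_minus Q2_norm_minus)

lemma Q2_Cauchy_minus: "Q2_Cauchy X \<Longrightarrow> Q2_Cauchy (\<lambda>n. - X n)"
  by (erule Q2_Cauchy_lipschitz[where B = 1]) (simp only: Q2_norm_minus_diff mult_1 order_refl)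

lemma Q2_Cauchy_scale: "Q2_Cauchy X \<Longrightarrow> Q2_Cauchy (\<lambda>n. free_scale c (X n))"
  by (erule Q2_Cauchy_lipschitz[where B = "cmod c"])
    (simp add: Q2_norm_scale flip: free_scale_diff)

lemma Q2_Cauchy_adj: "Q2_Cauchy X \<Longrightarrow> Q2_Cauchy (\<lambda>n. free_adj (X n))"
  by (erule Q2_Cauchy_lipschitz[where B = 1]) (simp add: Q2_norm_adj flip: free_adj_diff)

lemma Q2_Cauchy_add:
  assumes "Q2_Cauchy X" "Q2_Cauchy Y"
  shows "Q2_Cauchy (\<lambda>n. X n + Y n)"
  unfolding Q2_Cauchy_def
proof (intro allI impI)
  fix e :: real assume "0 < e"
  then have "0 < e / 2" by simp
  obtain M where M: "\<And>m n. m \<ge> M \<Longrightarrow> n \<ge> M \<Longrightarrow> Q2_norm (X m - X n) < e / 2"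
    using Q2_CauchyD[OF assms(1) \<open>0 < e / 2\<close>] by blast
  obtain N where N: "\<And>m n. m \<ge> N \<Longrightarrow> n \<ge> N \<Longrightarrow> Q2_norm (Y m - Y n) < e / 2"
    using Q2_CauchyD[OF assms(2) \<open>0 < e / 2\<close>] by blast
  have "Q2_norm (X m + Y m - (X n + Y n)) < e" if "m \<ge> max M N" "n \<ge> max M N" for m n
    using that M[of m n] N[of m n] Q2_norm_diff_add[of "X m" "Y m" "X n" "Y n"] by simp
  then show "\<exists>N. \<forall>m\<ge>N. \<forall>n\<ge>N. Q2_norm (X m + Y m - (X n + Y n)) < e" by blast
qed

lemma Q2_Cauchy_diff: "Q2_Cauchy X \<Longrightarrow> Q2_Cauchy Y \<Longrightarrow> Q2_Cauchy (\<lambda>n. X n - Y n)"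
  using Q2_Cauchy_add[OF _ Q2_Cauchy_minus] by simp

lemma Q2_Cauchy_convergent:
  assumes "Q2_Cauchy X"
  shows "convergent (\<lambda>n. Q2_norm (X n))"
proof (rule Cauchy_convergent, unfold Cauchy_iff, intro allI impI)
  fix e :: real assume "0 < e"
  then obtain N where N: "\<And>m n. m \<ge> N \<Longrightarrow> n \<ge> N \<Longrightarrow> Q2_norm (X m - X n) < e"
    using Q2_CauchyD[OF assms] by blast
  have "norm (Q2_norm (X m) - Q2_norm (X n)) < e" if "m \<ge> N" "n \<ge> N" for m n
    using N[OF that] Q2_norm_abs_diff[of "X m" "X n"] by simp
  then show "\<exists>N. \<forall>m\<ge>N. \<forall>n\<ge>N. norm (Q2_norm (X m) - Q2_norm (X n)) < e" by blast
qed

lemma Q2_Cauchy_bounded: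
  assumes "Q2_Cauchy X"
  obtains B where "0 < B" "\<And>n. Q2_norm (X n) \<le> B"
proof -
  have "Bseq (\<lambda>n. Q2_norm (X n))"
    by (rule convergent_imp_Bseq[OF Q2_Cauchy_convergent[OF assms]])
  then obtain B where B: "0 < B" "\<forall>n. norm (Q2_norm (X n)) \<le> B" by (rule BseqE)
  have "Q2_norm (X n) \<le> B" for n using B(2)[rule_format, of n] by simp
  with B(1) show ?thesis by (rule that)
qed

lemma Q2_Cauchy_mult:
  assumes "Q2_Cauchy X" "Q2_Cauchy Y"
  shows "Q2_Cauchy (\<lambda>n. X n * Y n)"
  unfolding Q2_Cauchy_def
proof (intro allI impI)
  fix e :: real assume e: "0 < e"
  obtain B where B: "0 < B" "\<And>n. Q2_norm (X n) \<le> B"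
    using Q2_Cauchy_bounded[OF assms(1)] by blast
  obtain C where C: "0 < C" "\<And>n. Q2_norm (Y n) \<le> C"
    using Q2_Cauchy_bounded[OF assms(2)] by blast
  have eC: "0 < e / (2 * C)" and eB: "0 < e / (2 * B)" using e B(1) C(1) by simp_all
  obtain M where M: "\<And>m n. m \<ge> M \<Longrightarrow> n \<ge> M \<Longrightarrow> Q2_norm (X m - X n) < e / (2 * C)"
    using Q2_CauchyD[OF assms(1) eC] by blast
  obtain N where N: "\<And>m n. m \<ge> N \<Longrightarrow> n \<ge> N \<Longrightarrow> Q2_norm (Y m - Y n) < e / (2 * B)"
    using Q2_CauchyD[OF assms(2) eB] by blast
  have "Q2_norm (X m * Y m - X n * Y n) < e" if mn: "m \<ge> max M N" "n \<ge> max M N" for m n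
  proof -
    have "Q2_norm (X m * Y m - X n * Y n)
        \<le> Q2_norm (X m) * Q2_norm (Y m - Y n) + Q2_norm (X m - X n) * Q2_norm (Y n)"
      by (rule Q2_norm_diff_mult)
    also have "\<dots> \<le> B * Q2_norm (Y m - Y n) + Q2_norm (X m - X n) * C"
      by (rule add_mono[OF mult_right_mono[OF B(2)] mult_left_mono[OF C(2)]]) simp_all
    also have "\<dots> < B * (e / (2 * B)) + e / (2 * C) * C"
    proof (rule add_strict_mono)
      show "B * Q2_norm (Y m - Y n) < B * (e / (2 * B))"
        using N[of m n] mn by (intro mult_strict_left_mono B(1)) simp
      show "Q2_norm (X m - X n) * C < e / (2 * C) * C"
        using M[of m n] mn by (intro mult_strict_right_mono C(1)) simp
    qed
    also have "\<dots> = e" using B(1) C(1) by simp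
    finally show ?thesis .
  qed
  then show "\<exists>N. \<forall>m\<ge>N. \<forall>n\<ge>N. Q2_norm (X m * Y m - X n * Y n) < e" by blast
qed

lemmas Q2_Cauchy_intros = Q2_Cauchy_const Q2_Cauchy_minus Q2_Cauchy_scale Q2_Cauchy_adj
  Q2_Cauchy_add Q2_Cauchy_diff Q2_Cauchy_mult

lemma Q2_rel_lipschitz:
  assumes "Q2_rel X Y" "Q2_Cauchy X'" "Q2_Cauchy Y'"
    and "\<And>n. Q2_norm (X' n - Y' n) \<le> B * Q2_norm (X n - Y n)"
  shows "Q2_rel X' Y'"
proof -
  have "(\<lambda>n. B * Q2_norm (X n - Y n)) \<longlonglongrightarrow> 0"
    using assms(1) by (intro tendsto_mult_right_zero) (simp add: Q2_rel_def)
  then have "(\<lambda>n. Q2_norm (X' n - Y' n)) \<longlonglongrightarrow> 0"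
    by (rule null_seq_le) (use assms(4) in simp)
  then show ?thesis using assms by (simp add: Q2_rel_def)
qed

instantiation Q2 :: "{zero, one, plus, minus, uminus, times}"
begin

lift_definition zero_Q2 :: Q2 is "\<lambda>_. 0" by (simp add: Q2_rel_refl)

lift_definition one_Q2 :: Q2 is "\<lambda>_. 1" by (simp add: Q2_rel_refl)

lift_definition uminus_Q2 :: "Q2 \<Rightarrow> Q2" is "\<lambda>X n. - X n"
proof -
  fix X Y assume "Q2_rel X Y"
  then show "Q2_rel (\<lambda>n. - X n) (\<lambda>n. - Y n)"
    by (rule Q2_rel_lipschitz[where B = 1])
      (use \<open>Q2_rel X Y\<close> in \<open>simp_all only: Q2_rel_def Q2_Cauchy_minus Q2_norm_minus_diff mult_1 order_refl\<close>)
qed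

lift_definition plus_Q2 :: "Q2 \<Rightarrow> Q2 \<Rightarrow> Q2" is "\<lambda>X Y n. X n + Y n"
proof -
  fix X X' Y Y' assume X: "Q2_rel X X'" and Y: "Q2_rel Y Y'"
  have "(\<lambda>n. Q2_norm (X n - X' n) + Q2_norm (Y n - Y' n)) \<longlonglongrightarrow> 0"
    using X Y by (intro tendsto_add_zero) (simp_all add: Q2_rel_def)
  then have "(\<lambda>n. Q2_norm (X n + Y n - (X' n + Y' n))) \<longlonglongrightarrow> 0"
    by (rule null_seq_le) (simp add: Q2_norm_diff_add)
  then show "Q2_rel (\<lambda>n. X n + Y n) (\<lambda>n. X' n + Y' n)"
    using X Y by (simp add: Q2_rel_def Q2_Cauchy_add)
qed

lift_definition times_Q2 :: "Q2 \<Rightarrow> Q2 \<Rightarrow> Q2" is "\<lambda>X Y n. X n * Y n"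
proof -
  fix X X' Y Y' assume X: "Q2_rel X X'" and Y: "Q2_rel Y Y'"
  obtain B where B: "\<And>n. Q2_norm (X n) \<le> B"
    using X Q2_Cauchy_bounded[of X] unfolding Q2_rel_def by blast
  obtain C where C: "\<And>n. Q2_norm (Y' n) \<le> C"
    using Y Q2_Cauchy_bounded[of Y'] unfolding Q2_rel_def by blast
  have "(\<lambda>n. B * Q2_norm (Y n - Y' n) + Q2_norm (X n - X' n) * C) \<longlonglongrightarrow> 0"
    using X Y by (intro tendsto_add_zero tendsto_mult_right_zero tendsto_mult_left_zero)
      (simp_all add: Q2_rel_def)
  moreover have "Q2_norm (X n * Y n - X' n * Y' n)
      \<le> B * Q2_norm (Y n - Y' n) + Q2_norm (X n - X' n) * C" for n
    by (rule order_trans[OF Q2_norm_diff_mult])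
      (intro add_mono mult_right_mono mult_left_mono B C, auto)
  ultimately have "(\<lambda>n. Q2_norm (X n * Y n - X' n * Y' n)) \<longlonglongrightarrow> 0"
    by - (rule null_seq_le, assumption, simp)
  then show "Q2_rel (\<lambda>n. X n * Y n) (\<lambda>n. X' n * Y' n)"
    using X Y by (simp add: Q2_rel_def Q2_Cauchy_mult)
qed

definition minus_Q2 :: "Q2 \<Rightarrow> Q2 \<Rightarrow> Q2" where "x - y = x + (- y)" for x y :: Q2

instance ..

end

lift_definition Q2_cnorm :: "Q2 \<Rightarrow> real" is "\<lambda>X. lim (\<lambda>n. Q2_norm (X n))"
proof -
  fix X Y assume XY: "Q2_rel X Y"
  then have "(\<lambda>n. Q2_norm (X n)) \<longlonglongrightarrow> lim (\<lambda>n. Q2_norm (X n))"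
    by (simp add: Q2_rel_def Q2_Cauchy_convergent flip: convergent_LIMSEQ_iff)
  moreover have "(\<lambda>n. Q2_norm (X n) - Q2_norm (Y n)) \<longlonglongrightarrow> 0"
    by (rule null_seq_le[of "\<lambda>n. Q2_norm (X n - Y n)"])
      (use XY in \<open>simp_all add: Q2_rel_def Q2_norm_abs_diff\<close>)
  ultimately have "(\<lambda>n. Q2_norm (X n) - (Q2_norm (X n) - Q2_norm (Y n)))
      \<longlonglongrightarrow> lim (\<lambda>n. Q2_norm (X n)) - 0"
    by (rule tendsto_diff)
  then show "lim (\<lambda>n. Q2_norm (X n)) = lim (\<lambda>n. Q2_norm (Y n))"
    by (simp add: limI)
qed

lift_definition Q2_scale :: "complex \<Rightarrow> Q2 \<Rightarrow> Q2" is "\<lambda>c X n. free_scale c (X n)"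
proof -
  fix c X Y assume "Q2_rel X Y"
  then show "Q2_rel (\<lambda>n. free_scale c (X n)) (\<lambda>n. free_scale c (Y n))"
    by (rule Q2_rel_lipschitz[where B = "cmod c"])
      (use \<open>Q2_rel X Y\<close> in \<open>auto simp: Q2_rel_def Q2_Cauchy_scale Q2_norm_scale simp flip: free_scale_diff\<close>)
qed

lift_definition Q2_adj :: "Q2 \<Rightarrow> Q2" is "\<lambda>X n. free_adj (X n)"
proof -
  fix X Y assume "Q2_rel X Y"
  then show "Q2_rel (\<lambda>n. free_adj (X n)) (\<lambda>n. free_adj (Y n))"
    by (rule Q2_rel_lipschitz[where B = 1])
      (use \<open>Q2_rel X Y\<close> in \<open>auto simp: Q2_rel_def Q2_Cauchy_adj Q2_norm_adj simp flip: free_adj_diff\<close>)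
qed

lemma Q2_exhaust:
  obtains X where "Q2_Cauchy X" "x = abs_Q2 X"
  by (metis Quotient3_abs_rep[OF Quotient3_Q2] Quotient3_rep_reflp[OF Quotient3_Q2] Q2_rel_def)

lemma abs_Q2_eq_iff: "Q2_Cauchy X \<Longrightarrow> Q2_Cauchy Y \<Longrightarrow> abs_Q2 X = abs_Q2 Y \<longleftrightarrow> Q2_rel X Y"
  using Quotient3_rel[OF Quotient3_Q2, of X Y] by (simp add: Q2_rel_refl)

lemma abs_Q2_simps:
  "Q2_Cauchy X \<Longrightarrow> Q2_Cauchy Y \<Longrightarrow> abs_Q2 X + abs_Q2 Y = abs_Q2 (\<lambda>n. X n + Y n)"
  "Q2_Cauchy X \<Longrightarrow> Q2_Cauchy Y \<Longrightarrow> abs_Q2 X * abs_Q2 Y = abs_Q2 (\<lambda>n. X n * Y n)"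
  "Q2_Cauchy X \<Longrightarrow> - abs_Q2 X = abs_Q2 (\<lambda>n. - X n)"
  "Q2_Cauchy X \<Longrightarrow> Q2_Cauchy Y \<Longrightarrow> abs_Q2 X - abs_Q2 Y = abs_Q2 (\<lambda>n. X n - Y n)"
  "Q2_Cauchy X \<Longrightarrow> Q2_scale c (abs_Q2 X) = abs_Q2 (\<lambda>n. free_scale c (X n))"
  "Q2_Cauchy X \<Longrightarrow> Q2_adj (abs_Q2 X) = abs_Q2 (\<lambda>n. free_adj (X n))"
  by (simp_all add: plus_Q2.abs_eq times_Q2.abs_eq uminus_Q2.abs_eq minus_Q2_def
      Q2_scale.abs_eq Q2_adj.abs_eq Q2_rel_refl Q2_Cauchy_minus)

lemma Q2_cnorm_tendsto:
  assumes "Q2_Cauchy X"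
  shows "(\<lambda>n. Q2_norm (X n)) \<longlonglongrightarrow> Q2_cnorm (abs_Q2 X)"
  using Q2_Cauchy_convergent[OF assms]
  by (simp add: Q2_cnorm.abs_eq Q2_rel_refl assms flip: convergent_LIMSEQ_iff)

instantiation Q2 :: ring_1
begin
instance
proof
  fix x y z :: Q2
  obtain X where X: "Q2_Cauchy X" "x = abs_Q2 X" by (rule Q2_exhaust)
  obtain Y where Y: "Q2_Cauchy Y" "y = abs_Q2 Y" by (rule Q2_exhaust)
  obtain Z where Z: "Q2_Cauchy Z" "z = abs_Q2 Z" by (rule Q2_exhaust)
  note [simp] = X Y Z abs_Q2_simps zero_Q2_def one_Q2_def Q2_Cauchy_intros
  show "x + y + z = x + (y + z)" "x + y = y + x" "0 + x = x" "- x + x = 0" "x - y = x + - y"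
    "x * y * z = x * (y * z)" "1 * x = x" "x * 1 = x"
    "(x + y) * z = x * z + y * z" "x * (y + z) = x * y + x * z"
    by (simp_all add: algebra_simps)
  show "(0::Q2) \<noteq> 1"
    using LIMSEQ_unique[of "\<lambda>_. 1::real" 0 1]
    by (auto simp: abs_Q2_eq_iff Q2_rel_def)
qed
end


lemma Q2_cnorm_zero: "Q2_cnorm x = 0 \<longleftrightarrow> x = 0"
proof -
  obtain X where X: "Q2_Cauchy X" "x = abs_Q2 X" by (rule Q2_exhaust)
  have "x = 0 \<longleftrightarrow> (\<lambda>n. Q2_norm (X n)) \<longlonglongrightarrow> 0"
    using X by (simp add: zero_Q2_def abs_Q2_eq_iff Q2_rel_def)
  moreover have "(\<lambda>n. Q2_norm (X n)) \<longlonglongrightarrow> Q2_cnorm x"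
    using Q2_cnorm_tendsto[OF X(1)] X(2) by simp
  ultimately show ?thesis by (metis LIMSEQ_unique)
qed

lemma Q2_cnorm_add: "Q2_cnorm (x + y) \<le> Q2_cnorm x + Q2_cnorm y"
proof -
  obtain X where X: "Q2_Cauchy X" "x = abs_Q2 X" by (rule Q2_exhaust)
  obtain Y where Y: "Q2_Cauchy Y" "y = abs_Q2 Y" by (rule Q2_exhaust)
  have "(\<lambda>n. Q2_norm (X n + Y n)) \<longlonglongrightarrow> Q2_cnorm (x + y)"
    using Q2_cnorm_tendsto[OF Q2_Cauchy_add[OF X(1) Y(1)]] X Y by (simp add: abs_Q2_simps)
  moreover have "(\<lambda>n. Q2_norm (X n) + Q2_norm (Y n)) \<longlonglongrightarrow> Q2_cnorm x + Q2_cnorm y"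
    unfolding X(2) Y(2) by (rule tendsto_add[OF Q2_cnorm_tendsto[OF X(1)] Q2_cnorm_tendsto[OF Y(1)]])
  ultimately show ?thesis by (rule LIMSEQ_le) (simp add: Q2_norm_add)
qed

lemma Q2_cnorm_mult: "Q2_cnorm (x * y) \<le> Q2_cnorm x * Q2_cnorm y"
proof -
  obtain X where X: "Q2_Cauchy X" "x = abs_Q2 X" by (rule Q2_exhaust)
  obtain Y where Y: "Q2_Cauchy Y" "y = abs_Q2 Y" by (rule Q2_exhaust)
  have "(\<lambda>n. Q2_norm (X n * Y n)) \<longlonglongrightarrow> Q2_cnorm (x * y)"
    using Q2_cnorm_tendsto[OF Q2_Cauchy_mult[OF X(1) Y(1)]] X Y by (simp add: abs_Q2_simps)
  moreover have "(\<lambda>n. Q2_norm (X n) * Q2_norm (Y n)) \<longlonglongrightarrow> Q2_cnorm x * Q2_cnorm y"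
    unfolding X(2) Y(2) by (rule tendsto_mult[OF Q2_cnorm_tendsto[OF X(1)] Q2_cnorm_tendsto[OF Y(1)]])
  ultimately show ?thesis by (rule LIMSEQ_le) (simp add: Q2_norm_mult)
qed

lemma Q2_cnorm_scale: "Q2_cnorm (Q2_scale c x) = cmod c * Q2_cnorm x"
proof -
  obtain X where X: "Q2_Cauchy X" "x = abs_Q2 X" by (rule Q2_exhaust)
  have "(\<lambda>n. cmod c * Q2_norm (X n)) \<longlonglongrightarrow> Q2_cnorm (Q2_scale c x)"
    using Q2_cnorm_tendsto[OF Q2_Cauchy_scale[OF X(1)]] X by (simp add: abs_Q2_simps Q2_norm_scale)
  moreover have "(\<lambda>n. cmod c * Q2_norm (X n)) \<longlonglongrightarrow> cmod c * Q2_cnorm x"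
    unfolding X(2) by (rule tendsto_mult_left[OF Q2_cnorm_tendsto[OF X(1)]])
  ultimately show ?thesis by (rule LIMSEQ_unique)
qed

lemma Q2_cnorm_adj_mult: "Q2_cnorm (Q2_adj x * x) = (Q2_cnorm x)\<^sup>2"
proof -
  obtain X where X: "Q2_Cauchy X" "x = abs_Q2 X" by (rule Q2_exhaust)
  have "(\<lambda>n. (Q2_norm (X n))\<^sup>2) \<longlonglongrightarrow> Q2_cnorm (Q2_adj x * x)"
    using Q2_cnorm_tendsto[OF Q2_Cauchy_mult[OF Q2_Cauchy_adj[OF X(1)] X(1)]] X
    by (simp add: abs_Q2_simps Q2_norm_cstar Q2_Cauchy_adj)
  moreover have "(\<lambda>n. (Q2_norm (X n))\<^sup>2) \<longlonglongrightarrow> (Q2_cnorm x)\<^sup>2"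
    unfolding X(2) by (rule tendsto_power[OF Q2_cnorm_tendsto[OF X(1)]])
  ultimately show ?thesis by (rule LIMSEQ_unique)
qed

lemma Q2_cnorm_const: "Q2_cnorm (abs_Q2 (\<lambda>_. f)) = Q2_norm f"
  by (rule LIMSEQ_unique[OF Q2_cnorm_tendsto[OF Q2_Cauchy_const] tendsto_const])

instantiation Q2 :: real_normed_algebra_1
begin

definition norm_Q2 :: "Q2 \<Rightarrow> real" where "norm = Q2_cnorm"
definition scaleR_Q2 :: "real \<Rightarrow> Q2 \<Rightarrow> Q2" where "r *\<^sub>R x = Q2_scale (complex_of_real r) x"
definition dist_Q2 :: "Q2 \<Rightarrow> Q2 \<Rightarrow> real" where "dist x y = norm (x - y)" for x y :: Q2
definition sgn_Q2 :: "Q2 \<Rightarrow> Q2" where "sgn x = inverse (norm x) *\<^sub>R x" for x :: Q2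
definition uniformity_Q2 :: "(Q2 \<times> Q2) filter" where
  "uniformity = (INF e\<in>{0<..}. principal {(x, y). dist x (y::Q2) < e})"
definition open_Q2 :: "Q2 set \<Rightarrow> bool" where
  "open S \<longleftrightarrow> (\<forall>x\<in>S. eventually (\<lambda>(x', y). x' = x \<longrightarrow> y \<in> S) uniformity)" for S :: "Q2 set"

instance
proof
  fix x y :: Q2 and a b :: real
  obtain X where X: "Q2_Cauchy X" "x = abs_Q2 X" by (rule Q2_exhaust)
  obtain Y where Y: "Q2_Cauchy Y" "y = abs_Q2 Y" by (rule Q2_exhaust)
  note [simp] = X Y abs_Q2_simps Q2_Cauchy_intros scaleR_Q2_def
  show "a *\<^sub>R (x + y) = a *\<^sub>R x + a *\<^sub>R y" by (simp add: free_scale_add)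
  show "(a + b) *\<^sub>R x = a *\<^sub>R x + b *\<^sub>R x" by (simp add: free_scale_add_left)
  show "a *\<^sub>R b *\<^sub>R x = (a * b) *\<^sub>R x" by (simp add: free_scale_scale)
  show "1 *\<^sub>R x = x" by simp
  show "a *\<^sub>R x * y = a *\<^sub>R (x * y)" by (simp add: free_scale_mult_left)
  show "x * a *\<^sub>R y = a *\<^sub>R (x * y)" by (simp add: free_scale_mult_right)
  show "norm (x + y) \<le> norm x + norm y" unfolding norm_Q2_def by (rule Q2_cnorm_add)
  show "norm (x * y) \<le> norm x * norm y" unfolding norm_Q2_def by (rule Q2_cnorm_mult)
  show "norm x = 0 \<longleftrightarrow> x = 0" unfolding norm_Q2_def by (rule Q2_cnorm_zero)
  show "norm (a *\<^sub>R x) = \<bar>a\<bar> * norm x"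
    unfolding norm_Q2_def scaleR_Q2_def by (simp only: Q2_cnorm_scale norm_of_real real_norm_def)
  show "norm (1::Q2) = 1" by (simp add: norm_Q2_def one_Q2_def Q2_cnorm_const)
qed (simp_all only: dist_Q2_def sgn_Q2_def uniformity_Q2_def open_Q2_def)

end

text \<open>The images of elements of the free *-algebra are dense.\<close>

definition of_free :: "free \<Rightarrow> Q2" where
  "of_free f = abs_Q2 (\<lambda>_. f)"

lemma of_free_add: "of_free (f + g) = of_free f + of_free g"
  and of_free_diff: "of_free (f - g) = of_free f - of_free g"
  and of_free_mult: "of_free (f * g) = of_free f * of_free g"
  and of_free_scale: "of_free (free_scale c f) = Q2_scale c (of_free f)"
  and of_free_adj: "of_free (free_adj f) = Q2_adj (of_free f)"
  and of_free_zero: "of_free 0 = 0"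
  and of_free_one: "of_free 1 = 1"
  by (simp_all add: of_free_def abs_Q2_simps zero_Q2_def one_Q2_def)

lemma norm_of_free: "norm (of_free f) = Q2_norm f"
  by (simp add: of_free_def norm_Q2_def Q2_cnorm_const)

lemma of_free_tendsto:
  assumes X: "Q2_Cauchy X"
  shows "(\<lambda>n. of_free (X n)) \<longlonglongrightarrow> abs_Q2 X"
proof (rule LIMSEQ_I)
  fix e :: real assume "0 < e"
  then have "0 < e / 2" by simp
  then obtain N where N: "\<And>m n. m \<ge> N \<Longrightarrow> n \<ge> N \<Longrightarrow> Q2_norm (X m - X n) < e / 2"
    using X unfolding Q2_Cauchy_def by blast
  have "norm (of_free (X m) - abs_Q2 X) < e" if m: "m \<ge> N" for m
  proof -
    have "(\<lambda>n. Q2_norm (X m - X n)) \<longlonglongrightarrow> norm (of_free (X m) - abs_Q2 X)"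
      using Q2_cnorm_tendsto[OF Q2_Cauchy_diff[OF Q2_Cauchy_const X], of "X m"] X
      by (simp add: norm_Q2_def of_free_def abs_Q2_simps)
    then have "norm (of_free (X m) - abs_Q2 X) \<le> e / 2"
      by (rule LIMSEQ_le_const2) (use N[OF m] in \<open>auto intro: less_imp_le\<close>)
    then show ?thesis using \<open>0 < e\<close> by simp
  qed
  then show "\<exists>N. \<forall>m\<ge>N. norm (of_free (X m) - abs_Q2 X) < e" by blast
qed

lemma Q2_Cauchy_of_free: "Q2_Cauchy X \<longleftrightarrow> Cauchy (\<lambda>n. of_free (X n))"
  by (simp add: Cauchy_iff Q2_Cauchy_def norm_of_free flip: of_free_diff)

lemma of_free_dense:
  assumes "0 < e"
  obtains f where "norm (x - of_free f) < e"
proof -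
  obtain X where X: "Q2_Cauchy X" "x = abs_Q2 X" by (rule Q2_exhaust)
  from LIMSEQ_D[OF of_free_tendsto[OF X(1)] assms] X(2) that show ?thesis
    by (metis norm_minus_commute order_refl)
qed

instance Q2 :: banach
proof
  fix x :: "nat \<Rightarrow> Q2" assume x: "Cauchy x"
  have "\<exists>f. norm (x n - of_free f) < inverse (real (Suc n))" for n
    by (rule of_free_dense[of "inverse (real (Suc n))" "x n"]) auto
  then obtain X where X: "\<And>n. norm (x n - of_free (X n)) < inverse (real (Suc n))" by metis
  have lim: "(\<lambda>n. x n - of_free (X n)) \<longlonglongrightarrow> 0"
    by (rule null_seq_le[OF LIMSEQ_inverse_real_of_nat]) (rule less_imp_le[OF X])
  have "Cauchy (\<lambda>n. of_free (X n))"
  proof (rule CauchyI)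
    fix e :: real assume "0 < e"
    then have e3: "0 < e / 3" by simp
    obtain M where M: "\<And>m n. m \<ge> M \<Longrightarrow> n \<ge> M \<Longrightarrow> norm (x m - x n) < e / 3"
      using CauchyD[OF x e3] by blast
    obtain N where N: "\<And>n. n \<ge> N \<Longrightarrow> norm (x n - of_free (X n)) < e / 3"
      using LIMSEQ_D[OF lim e3] by auto
    have "norm (of_free (X m) - of_free (X n)) < e" if "m \<ge> max M N" "n \<ge> max M N" for m n
    proof -
      have "of_free (X m) - of_free (X n)
          = (x m - x n) - (x m - of_free (X m)) + (x n - of_free (X n))" by simp
      then have "norm (of_free (X m) - of_free (X n))
          \<le> norm (x m - x n) + norm (x m - of_free (X m)) + norm (x n - of_free (X n))"
        by (metis add_right_mono norm_triangle_ineq norm_triangle_ineq4 order_trans)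
      then show ?thesis using M[of m n] N[of m] N[of n] that by simp
    qed
    then show "\<exists>N. \<forall>m\<ge>N. \<forall>n\<ge>N. norm (of_free (X m) - of_free (X n)) < e" by blast
  qed
  then have "Q2_Cauchy X" by (simp add: Q2_Cauchy_of_free)
  then have "(\<lambda>n. of_free (X n)) \<longlonglongrightarrow> abs_Q2 X" by (rule of_free_tendsto)
  from tendsto_add[OF lim this] show "convergent x" by (auto simp: convergent_def)
qed

instantiation Q2 :: cstar_algebra
begin

definition scaleC_Q2 :: "complex \<Rightarrow> Q2 \<Rightarrow> Q2" where "scaleC = Q2_scale"
definition adj_Q2 :: "Q2 \<Rightarrow> Q2" where "adj = Q2_adj"

instance
proof
  fix x y :: Q2 and a b :: complex and r :: real
  obtain X where X: "Q2_Cauchy X" "x = abs_Q2 X" by (rule Q2_exhaust)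
  obtain Y where Y: "Q2_Cauchy Y" "y = abs_Q2 Y" by (rule Q2_exhaust)
  note [simp] = X Y abs_Q2_simps Q2_Cauchy_intros scaleC_Q2_def adj_Q2_def
  show "r *\<^sub>R x = complex_of_real r *\<^sub>C x" by (simp add: scaleR_Q2_def)
  show "a *\<^sub>C (x + y) = a *\<^sub>C x + a *\<^sub>C y" by (simp add: free_scale_add)
  show "(a + b) *\<^sub>C x = a *\<^sub>C x + b *\<^sub>C x" by (simp add: free_scale_add_left)
  show "a *\<^sub>C b *\<^sub>C x = (a * b) *\<^sub>C x" by (simp add: free_scale_scale)
  show "1 *\<^sub>C x = x" by simp
  show "a *\<^sub>C x * y = a *\<^sub>C (x * y)" by (simp add: free_scale_mult_left)
  show "x * a *\<^sub>C y = a *\<^sub>C (x * y)" by (simp add: free_scale_mult_right)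
  show "norm (a *\<^sub>C x) = cmod a * norm x"
    unfolding norm_Q2_def scaleC_Q2_def by (rule Q2_cnorm_scale)
  show "(x + y)\<^sup>\<star> = x\<^sup>\<star> + y\<^sup>\<star>" by (simp add: free_adj_add)
  show "(a *\<^sub>C x)\<^sup>\<star> = cnj a *\<^sub>C x\<^sup>\<star>" by (simp add: free_adj_scale)
  show "(x * y)\<^sup>\<star> = y\<^sup>\<star> * x\<^sup>\<star>" by (simp add: free_adj_mult)
  show "(x\<^sup>\<star>)\<^sup>\<star> = x" by simp
  show "norm (x\<^sup>\<star> * x) = (norm x)\<^sup>2"
    unfolding norm_Q2_def adj_Q2_def by (rule Q2_cnorm_adj_mult)
qed

end

definition U :: Q2 where "U = of_free free_u"

definition S\<^sub>2 :: Q2 where "S\<^sub>2 = of_free free_s"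

definition S\<^sub>1 :: Q2 where "S\<^sub>1 = U * S\<^sub>2"

text \<open>The Cuntz algebra \<open>O\<^sub>2\<close> inside \<^typ>\<open>Q2\<close>.\<close>

definition O\<^sub>2 :: "Q2 set" where "O\<^sub>2 = cstar_generated {S\<^sub>1, S\<^sub>2}"

section \<open>Generators, relations and universal property\<close>

definition Q2_relations :: "'a::cstar_algebra \<Rightarrow> 'a \<Rightarrow> bool" where
  "Q2_relations V T \<longleftrightarrow>
     V\<^sup>\<star> * V = 1 \<and> V * V\<^sup>\<star> = 1 \<and> T\<^sup>\<star> * T = 1 \<and>
     T * V = V\<^sup>2 * T \<and> T * T\<^sup>\<star> + V * T * T\<^sup>\<star> * V\<^sup>\<star> = 1"

lemma Q2_relations_generators: "Q2_relations U S\<^sub>2"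
proof -
  have *: "of_free r = 0" if "r \<in> Q2_relators" for r
    using Q2_norm_relator[OF that] by (simp flip: norm_of_free)
  have "of_free f = of_free g" if "f - g \<in> Q2_relators" for f g
    using *[OF that] by (simp add: of_free_diff)
  note eq = this[unfolded Q2_relators_def]
  note [simp] = of_free_add of_free_mult of_free_adj of_free_one
  show ?thesis
    using eq[of "free_adj free_u * free_u" 1] eq[of "free_u * free_adj free_u" 1]
      eq[of "free_adj free_s * free_s" 1] eq[of "free_s * free_u" "free_u * free_u * free_s"]
      eq[of "free_s * free_adj free_s + free_u * free_s * free_adj free_s * free_adj free_u" 1]
    by (simp add: Q2_relations_def U_def S\<^sub>2_def adj_Q2_def power2_eq_square del: free_adj_letter)
qed

lemma cstar_generated_subalgebra: "cstar_subalgebra (cstar_generated X)"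
  unfolding cstar_generated_def
  by (rule hull_in) (auto simp: cstar_subalgebra_def)

lemma cstar_generated_superset: "X \<subseteq> cstar_generated X"
  unfolding cstar_generated_def by (rule hull_subset)

lemma Q2_generated: "cstar_generated {U, S\<^sub>2} = UNIV"
proof -
  let ?A = "cstar_generated {U, S\<^sub>2}"
  have A: "closed ?A" "0 \<in> ?A" "\<And>x y. x \<in> ?A \<Longrightarrow> y \<in> ?A \<Longrightarrow> x + y \<in> ?A"
    "\<And>c x. x \<in> ?A \<Longrightarrow> c *\<^sub>C x \<in> ?A" "\<And>x y. x \<in> ?A \<Longrightarrow> y \<in> ?A \<Longrightarrow> x * y \<in> ?A"
    "\<And>x. x \<in> ?A \<Longrightarrow> x\<^sup>\<star> \<in> ?A" "U \<in> ?A" "S\<^sub>2 \<in> ?A"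
    using cstar_generated_subalgebra[of "{U, S\<^sub>2}"] cstar_generated_superset[of "{U, S\<^sub>2}"]
    by (auto simp: cstar_subalgebra_def)
  have one: "1 \<in> ?A" using A(5)[OF A(6)[OF A(7)] A(7)] Q2_relations_generators by (simp add: Q2_relations_def)
  have letter: "of_free (free_letter l) \<in> ?A" for l
    using A(7,8) A(6)[OF A(7)] A(6)[OF A(8)]
    by (cases l) (simp_all add: U_def S\<^sub>2_def adj_Q2_def flip: of_free_adj)
  have "of_free (Poly_Mapping.single (Word ls) 1) \<in> ?A" for ls
  proof (induction ls)
    case Nil
    then show ?case using one by (simp add: of_free_one flip: zero_word_def)
  next
    case (Cons l ls)
    have "Poly_Mapping.single (Word (l # ls)) 1 = free_letter l * Poly_Mapping.single (Word ls) 1"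
      by (simp add: free_letter_def mult_single plus_word_def)
    then show ?case using A(5)[OF letter[of l] Cons] by (simp add: of_free_mult)
  qed
  then have word: "of_free (Poly_Mapping.single w 1) \<in> ?A" for w by (cases w) simp
  have free: "of_free f \<in> ?A" for f
  proof (induction f rule: free_induct)
    case (single w c)
    show ?case using A(4)[OF word[of w], of c] by (simp add: scaleC_Q2_def flip: of_free_scale)
  qed (simp add: of_free_add A)
  have "x \<in> ?A" for x
  proof -
    obtain X where X: "Q2_Cauchy X" "x = abs_Q2 X" by (rule Q2_exhaust)
    show ?thesis
      using closed_sequentially[OF A(1) _ of_free_tendsto[OF X(1)]] free X(2) by blast
  qed
  then show ?thesis by blast
qed

fun letter_val :: "'a::cstar_algebra \<Rightarrow> 'a \<Rightarrow> letter \<Rightarrow> 'a" where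
  "letter_val V T LU = V"
| "letter_val V T LUadj = V\<^sup>\<star>"
| "letter_val V T LS = T"
| "letter_val V T LSadj = T\<^sup>\<star>"

definition word_val :: "'a::cstar_algebra \<Rightarrow> 'a \<Rightarrow> word \<Rightarrow> 'a" where
  "word_val V T w = prod_list (map (letter_val V T) (letters w))"

definition free_val :: "'a::cstar_algebra \<Rightarrow> 'a \<Rightarrow> free \<Rightarrow> 'a" where
  "free_val V T = lin_ext (word_val V T)"

lemma word_val_plus: "word_val V T (v + w) = word_val V T v * word_val V T w"
  by (simp add: word_val_def)

lemma word_val_adj: "word_val V T (word_adj w) = (word_val V T w)\<^sup>\<star>"
proof -
  have l: "letter_val V T (letter_adj l) = (letter_val V T l)\<^sup>\<star>" for l
    by (cases l) (simp_all add: adj_adj)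
  have "prod_list (map (letter_val V T) (rev (map letter_adj ls)))
      = (prod_list (map (letter_val V T) ls))\<^sup>\<star>" for ls
    by (induction ls) (simp_all add: adj_mult l)
  then show ?thesis by (simp add: word_val_def word_adj_def)
qed

lemma free_val_single: "free_val V T (Poly_Mapping.single w c) = c *\<^sub>C word_val V T w"
  and free_val_add: "free_val V T (f + g) = free_val V T f + free_val V T g"
  and free_val_diff: "free_val V T (f - g) = free_val V T f - free_val V T g"
  and free_val_scale: "free_val V T (free_scale c f) = c *\<^sub>C free_val V T f"
  by (simp_all add: free_val_def lin_ext_add lin_ext_diff lin_ext_scale)

lemma free_val_one: "free_val V T 1 = 1"
  using free_val_single[of V T 0 1] by (simp add: word_val_def scaleC_one)

lemma free_val_letter: "free_val V T (free_letter l) = letter_val V T l"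
  by (simp add: free_letter_def free_val_single word_val_def scaleC_one)

lemma free_val_mult: "free_val V T (f * g) = free_val V T f * free_val V T g"
proof (induction f rule: free_induct)
  case (single v c)
  show ?case
    by (induction g rule: free_induct)
      (simp_all add: distrib_left free_val_add mult_single free_val_single word_val_plus
        mult_scaleC_left mult_scaleC_right scaleC_scaleC mult.commute[of c])
qed (simp add: distrib_right free_val_add)

lemma free_val_adj: "free_val V T (free_adj f) = (free_val V T f)\<^sup>\<star>"
  by (induction f rule: free_induct)
    (simp_all add: free_adj_add free_val_add free_val_single adj_add adj_scaleC word_val_adj)

lemma Q2_seminorm_free_val:
  assumes "Q2_relations V T"
  shows "Q2_seminorm (\<lambda>f. norm (free_val V T f))"
proof -
  have "free_val V T r = 0" if "r \<in> Q2_relators" for r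
    using that assms unfolding Q2_relators_def Q2_relations_def
    by (auto simp: free_val_add free_val_diff free_val_mult free_val_one free_val_letter
        power2_eq_square)
  then show ?thesis
    by (simp add: Q2_seminorm_def free_val_add free_val_scale free_val_mult free_val_adj
        norm_triangle_ineq norm_scaleC norm_mult_ineq norm_adj_mult)
qed

lemma bounded_linear_adj: "bounded_linear (adj :: 'a::cstar_algebra \<Rightarrow> 'a)"
proof
  fix x y :: 'a and r :: real
  show "(x + y)\<^sup>\<star> = x\<^sup>\<star> + y\<^sup>\<star>" by (rule adj_add)
  show "(r *\<^sub>R x)\<^sup>\<star> = r *\<^sub>R x\<^sup>\<star>" by (simp add: scaleR_scaleC adj_scaleC)
  have "norm z \<le> norm (z\<^sup>\<star>)" for z :: 'a
    using norm_mult_ineq[of "z\<^sup>\<star>" z] by (cases "z = 0") (auto simp: norm_adj_mult power2_eq_square)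
  from this[of "x\<^sup>\<star>" for x :: 'a] show "\<exists>K. \<forall>x::'a. norm (x\<^sup>\<star>) \<le> norm x * K"
    by (intro exI[of _ 1]) (simp add: adj_adj)
qed

lemma bounded_linear_scaleC: "bounded_linear (\<lambda>x::'a::cstar_algebra. c *\<^sub>C x)"
proof
  fix x y :: 'a and r :: real
  show "c *\<^sub>C (x + y) = c *\<^sub>C x + c *\<^sub>C y" by (rule scaleC_add_right)
  show "c *\<^sub>C r *\<^sub>R x = r *\<^sub>R c *\<^sub>C x" by (simp add: scaleR_scaleC scaleC_scaleC mult.commute)
  show "\<exists>K. \<forall>x::'a. norm (c *\<^sub>C x) \<le> norm x * K"
    by (intro exI[of _ "cmod c"]) (simp add: norm_scaleC mult.commute)
qed

text \<open>With \<open>Q2_relations_generators\<close> this is the existence part of the universal property;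
  uniqueness follows from \<open>Q2_generated\<close> and the continuity of *-homomorphisms.\<close>

lemma Q2_universal:
  fixes V T :: "'a::cstar_algebra"
  assumes rel: "Q2_relations V T"
  shows "\<exists>\<phi> :: Q2 \<Rightarrow> 'a. unital_star_hom \<phi> \<and> \<phi> U = V \<and> \<phi> S\<^sub>2 = T"
proof -
  let ?v = "free_val V T"
  have le: "norm (?v f) \<le> Q2_norm f" for f
    by (rule Q2_seminorm_le_norm[OF Q2_seminorm_free_val[OF rel]])
  have conv: "convergent (\<lambda>n. ?v (X n))" if "Q2_Cauchy X" for X
  proof (rule Cauchy_convergent, unfold Cauchy_iff, intro allI impI)
    fix e :: real assume "0 < e"
    then show "\<exists>N. \<forall>m\<ge>N. \<forall>n\<ge>N. norm (?v (X m) - ?v (X n)) < e"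
      using that unfolding Q2_Cauchy_def
      by (metis free_val_diff le le_less_trans)
  qed
  have ex: "\<exists>l. \<forall>X. Q2_Cauchy X \<and> x = abs_Q2 X \<longrightarrow> (\<lambda>n. ?v (X n)) \<longlonglongrightarrow> l" for x
  proof -
    obtain X where X: "Q2_Cauchy X" "x = abs_Q2 X" by (rule Q2_exhaust)
    obtain l where l: "(\<lambda>n. ?v (X n)) \<longlonglongrightarrow> l" using conv[OF X(1)] by (auto simp: convergent_def)
    have "(\<lambda>n. ?v (Y n)) \<longlonglongrightarrow> l" if Y: "Q2_Cauchy Y" "x = abs_Q2 Y" for Y
    proof -
      have "Q2_rel Y X" using X Y by (simp flip: abs_Q2_eq_iff)
      then have "(\<lambda>n. ?v (Y n) - ?v (X n)) \<longlonglongrightarrow> 0"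
        by - (rule null_seq_le[of "\<lambda>n. Q2_norm (Y n - X n)"],
          simp_all add: Q2_rel_def le flip: free_val_diff)
      from tendsto_add[OF this l] show ?thesis by simp
    qed
    then show ?thesis by blast
  qed
  then obtain \<phi> where \<phi>: "\<And>X. Q2_Cauchy X \<Longrightarrow> (\<lambda>n. ?v (X n)) \<longlonglongrightarrow> \<phi> (abs_Q2 X)" by metis
  have of_free: "\<phi> (of_free f) = ?v f" for f
    using \<phi>[OF Q2_Cauchy_const, of f] by (simp add: of_free_def LIMSEQ_const_iff)
  have "unital_star_hom \<phi>"
    unfolding unital_star_hom_def
  proof (intro conjI allI)
    fix x y :: Q2 and c
    obtain X where X: "Q2_Cauchy X" "x = abs_Q2 X" by (rule Q2_exhaust)
    obtain Y where Y: "Q2_Cauchy Y" "y = abs_Q2 Y" by (rule Q2_exhaust)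
    note [simp] = X Y abs_Q2_simps
    note tends = LIMSEQ_unique[OF \<phi>]
    show "\<phi> (x + y) = \<phi> x + \<phi> y"
      using tends[OF Q2_Cauchy_add[OF X(1) Y(1)], of "\<phi> x + \<phi> y"]
        tendsto_add[OF \<phi>[OF X(1)] \<phi>[OF Y(1)]]
      by (simp add: free_val_add)
    show "\<phi> (x * y) = \<phi> x * \<phi> y"
      using tends[OF Q2_Cauchy_mult[OF X(1) Y(1)], of "\<phi> x * \<phi> y"]
        tendsto_mult[OF \<phi>[OF X(1)] \<phi>[OF Y(1)]]
      by (simp add: free_val_mult)
    show "\<phi> (c *\<^sub>C x) = c *\<^sub>C \<phi> x"
      using tends[OF Q2_Cauchy_scale[OF X(1)], of c "c *\<^sub>C \<phi> x"]
        bounded_linear.tendsto[OF bounded_linear_scaleC \<phi>[OF X(1)], of c]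
      by (simp add: free_val_scale scaleC_Q2_def)
    show "\<phi> (x\<^sup>\<star>) = (\<phi> x)\<^sup>\<star>"
      using tends[OF Q2_Cauchy_adj[OF X(1)], of "(\<phi> x)\<^sup>\<star>"]
        bounded_linear.tendsto[OF bounded_linear_adj \<phi>[OF X(1)]]
      by (simp add: free_val_adj adj_Q2_def)
    show "\<phi> 1 = 1" using of_free[of 1] by (simp add: of_free_one free_val_one)
  qed
  moreover have "\<phi> U = V" "\<phi> S\<^sub>2 = T"
    by (simp_all add: U_def S\<^sub>2_def of_free free_val_letter)
  ultimately show ?thesis by blast
qed

end

theory Submission
  imports Defs "HOL-Computational_Algebra.Polynomial"
begin

text \<open>
  Put \<open>V = \<Lambda> U\<close>. As \<open>\<Lambda>\<close> fixes \<open>S\<^sub>2\<close> and \<open>S\<^sub>1 = U S\<^sub>2\<close>, the unitary \<open>V\<close> satisfies \<open>V S\<^sub>2 = U S\<^sub>2\<close> and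
  \<open>S\<^sub>2 V = V\<^sup>2 S\<^sub>2\<close>. The defect \<open>F = V U\<^sup>\<star> - 1\<close> is then normal, commutes with \<open>S\<^sub>2\<close> and kills \<open>S\<^sub>1\<close>. These
  algebraic properties alone do not give \<open>F = 0\<close>: on \<open>\<ell>\<^sup>2(\<int>)\<close>, with \<open>U e\<^sub>k = e\<^sub>k\<^sub>+\<^sub>1\<close> and \<open>S\<^sub>2 e\<^sub>k = e\<^sub>2\<^sub>k\<close>,
  every scalar multiple of the projection onto \<open>e\<^sub>0\<close> has them. What excludes such operators is that
  \<open>F\<close> lies in the norm closure of the polynomials in \<open>U\<close>, \<open>S\<^sub>2\<close> and their adjoints.

  Compressing by large powers of \<open>S\<^sub>2\<close> makes \<open>U\<close> disappear: an exponent \<open>a \<noteq> 0\<close> is not divisible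
  by arbitrarily high powers of \<open>2\<close>, so \<open>(S\<^sub>2\<^sup>\<star>)\<^sup>n U\<^sup>a S\<^sub>2\<^sup>n = 0\<close> for large \<open>n\<close>. Hence, for every \<open>x\<close>, the
  element \<open>(S\<^sub>2\<^sup>\<star>)\<^sup>n x S\<^sub>2\<^sup>2\<^sup>n\<close> comes arbitrarily close to polynomials in \<open>S\<^sub>2\<close>
  (\<open>compression_near_poly_at\<close>). For \<open>x = F\<close> it equals \<open>F S\<^sub>2\<^sup>n\<close>, since \<open>F\<close> commutes with \<open>S\<^sub>2\<close>.

  So \<open>H = F S\<^sub>2\<^sup>n\<close> is within \<open>\<epsilon>\<close> of some \<open>q = p(S\<^sub>2)\<close>. As \<open>H\<close> kills \<open>q\<^sup>k S\<^sub>1\<close>, one gets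
  \<open>\<parallel>q\<^sup>k S\<^sub>1\<parallel> \<le> \<epsilon>\<^sup>k\<close>. The isometries \<open>S\<^sub>2\<^sup>i S\<^sub>1\<close> have orthogonal ranges, so this bounds every coefficient
  of \<open>p\<^sup>k\<close> by \<open>\<epsilon>\<^sup>k\<close>, and \<open>\<parallel>q\<^sup>k\<parallel>\<close> is at most \<open>\<epsilon>\<^sup>k\<close> times a factor that grows only linearly in \<open>k\<close>.
  Therefore \<open>\<parallel>H\<^sup>N\<parallel>\<close> is at most \<open>(2\<epsilon>)\<^sup>N\<close> up to a linear factor; since \<open>H\<close> is normal, taking roots
  yields \<open>\<parallel>F\<parallel> = \<parallel>H\<parallel> \<le> 2\<epsilon>\<close> (\<open>normal_commutant_zero\<close>). Thus \<open>F = 0\<close> and \<open>\<Lambda> U = U\<close>.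

  It remains to pass from the generators to the whole algebra, which requires \<open>\<Lambda>\<close> to be continuous.
  A *-homomorphism is contractive because a selfadjoint strict contraction is the mean of a
  unitary and its adjoint (\<open>star_hom_norm_le\<close>).
\<close>

section \<open>Isometries and normal elements\<close>

lemma norm_isometry:
  fixes T :: "'a::cstar_algebra"
  assumes "T\<^sup>\<star> * T = 1"
  shows "norm T = 1"
  using norm_adj_mult[of T] assms by (simp add: power2_eq_1_iff) (smt (verit) norm_ge_zero)

lemma norm_adj: "norm (x\<^sup>\<star>) = norm (x::'a::cstar_algebra)"
proof -
  have le: "norm z \<le> norm (z\<^sup>\<star>)" for z :: 'a
    using norm_mult_ineq[of "z\<^sup>\<star>" z] by (cases "z = 0") (auto simp: norm_adj_mult power2_eq_square)
  show ?thesis using le[of x] le[of "x\<^sup>\<star>"] by (simp add: adj_adj)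
qed

lemma adj_zero: "(0::'a::cstar_algebra)\<^sup>\<star> = 0"
  using adj_scaleC[of 0 0] by simp

lemma adj_power: "(x ^ n)\<^sup>\<star> = (x\<^sup>\<star>) ^ n" for x :: "'a::cstar_algebra"
  by (induction n) (simp_all add: adj_mult power_commutes)

lemma isometry_power:
  fixes T :: "'a::cstar_algebra"
  assumes "T\<^sup>\<star> * T = 1"
  shows "(T\<^sup>\<star>) ^ n * T ^ n = 1"
proof (induction n)
  case (Suc n)
  have "(T\<^sup>\<star>) ^ Suc n * T ^ Suc n = (T\<^sup>\<star>) ^ n * (T\<^sup>\<star> * T) * T ^ n"
    by (simp only: power_Suc2[of "T\<^sup>\<star>"] power_Suc[of T] mult.assoc)
  then show ?case using Suc assms by simp
qed simp

text \<open>By the C*-identity both squared norms are the norm of the same element: normality turns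
  \<open>(x\<^sup>2)\<^sup>\<star> x\<^sup>2\<close> into \<open>(x\<^sup>\<star> x)\<^sup>\<star> (x\<^sup>\<star> x)\<close>.\<close>

lemma norm_normal_square:
  fixes x :: "'a::cstar_algebra"
  assumes "x\<^sup>\<star> * x = x * x\<^sup>\<star>"
  shows "norm (x\<^sup>2) = (norm x)\<^sup>2"
proof -
  have "(norm (x\<^sup>2))\<^sup>2 = norm ((x\<^sup>2)\<^sup>\<star> * x\<^sup>2)" by (simp add: norm_adj_mult)
  also have "(x\<^sup>2)\<^sup>\<star> * x\<^sup>2 = x\<^sup>\<star> * (x\<^sup>\<star> * x) * x"
    by (simp add: adj_mult power2_eq_square mult.assoc)
  also have "\<dots> = (x\<^sup>\<star> * x)\<^sup>\<star> * (x\<^sup>\<star> * x)"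
    by (simp add: adj_mult adj_adj mult.assoc) (simp add: assms mult.assoc flip: mult.assoc[of "x\<^sup>\<star>" x])
  also have "norm \<dots> = ((norm x)\<^sup>2)\<^sup>2" by (simp only: norm_adj_mult)
  finally show ?thesis by (metis norm_ge_zero power2_eq_iff_nonneg zero_le_power2)
qed

lemma norm_normal_power:
  fixes x :: "'a::cstar_algebra"
  assumes "x\<^sup>\<star> * x = x * x\<^sup>\<star>"
  shows "norm (x ^ (2 ^ j)) = norm x ^ (2 ^ j)"
  using assms
proof (induction j arbitrary: x)
  case (Suc j)
  have "(x\<^sup>2)\<^sup>\<star> * x\<^sup>2 = x\<^sup>2 * (x\<^sup>2)\<^sup>\<star>"
    by (simp add: adj_power flip: power_mult_distrib)
       (metis Suc.prems power_commuting_commutes)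
  then have "norm ((x\<^sup>2) ^ (2 ^ j)) = norm (x\<^sup>2) ^ (2 ^ j)" by (rule Suc.IH)
  then show ?case using norm_normal_square[OF Suc.prems] by (simp add: power_mult)
qed simp

section \<open>Contractivity of *-homomorphisms\<close>

text \<open>Writing \<open>y = 1 - z\<close>, the equation \<open>y\<^sup>2 = 1 - h\<^sup>2\<close> says that \<open>z\<close> is a fixed point of
  \<open>z \<mapsto> (h\<^sup>2 + z\<^sup>2) / 2\<close>. This map is a contraction of the ball of radius \<open>\<parallel>h\<parallel> < 1\<close>, and it preserves the
  closed set of selfadjoint elements commuting with \<open>h\<close>.\<close>

lemma selfadjoint_sqrt:
  fixes h :: "'a::cstar_algebra"
  assumes h: "h\<^sup>\<star> = h" "norm h < 1"
  obtains y where "y\<^sup>\<star> = y" "y * h = h * y" "y * y = 1 - h * h"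
proof -
  define S where "S = {z. norm z \<le> norm h \<and> z\<^sup>\<star> = z \<and> z * h = h * z}"
  define f where "f z = (1/2) *\<^sub>R (h * h + z * z)" for z
  have "closed S"
    unfolding S_def
    by (intro closed_Collect_conj closed_Collect_le closed_Collect_eq continuous_intros
        bounded_linear.continuous_on[OF bounded_linear_adj])
  then have "complete S" by (simp add: complete_eq_closed)
  moreover have "S \<noteq> {}" using h by (auto simp: S_def)
  moreover have "f ` S \<subseteq> S"
  proof (intro image_subsetI)
    fix z assume "z \<in> S"
    then have z: "norm z \<le> norm h" "z\<^sup>\<star> = z" "z * h = h * z" by (auto simp: S_def)
    have "norm (h * h + z * z) \<le> norm h * norm h + norm z * norm z"
      by (meson add_mono norm_mult_ineq norm_triangle_le)
    also have "\<dots> \<le> norm h * 1 + norm h * 1"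
      using z(1) h(2) by (intro add_mono mult_mono) auto
    finally have "norm (f z) \<le> norm h" by (simp add: f_def)
    moreover have "(f z)\<^sup>\<star> = f z"
      using z(2) h(1) by (simp add: f_def scaleR_scaleC adj_scaleC adj_add adj_mult)
    moreover have "f z * h = h * f z"
      using z(3) by (simp add: f_def distrib_left distrib_right) (metis mult.assoc)
    ultimately show "f z \<in> S" by (simp add: S_def)
  qed
  moreover have "dist (f z) (f w) \<le> norm h * dist z w" if "z \<in> S" "w \<in> S" for z w
  proof -
    have "f z - f w = (1/2) *\<^sub>R (z * (z - w) + (z - w) * w)"
      by (simp add: f_def algebra_simps)
    then have "norm (f z - f w) \<le> (1/2) * (norm z * norm (z - w) + norm (z - w) * norm w)"
      by (simp add: norm_triangle_le add_mono norm_mult_ineq)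
    also have "\<dots> \<le> (1/2) * (norm h * norm (z - w) + norm (z - w) * norm h)"
      using that by (intro mult_left_mono add_mono mult_right_mono) (auto simp: S_def)
    finally show ?thesis by (simp add: dist_norm)
  qed
  ultimately have "\<exists>!z\<in>S. f z = z"
    using h(2) by (intro Banach_fix[of S "norm h"]) auto
  then obtain z where z: "z \<in> S" "f z = z" by blast
  have "2 *\<^sub>R f z = h * h + z * z" by (simp add: f_def)
  then have "h * h = z + z - z * z" by (simp add: z scaleR_2)
  then have "(1 - z) * (1 - z) = 1 - h * h" by (simp add: algebra_simps)
  moreover have "(1 - z)\<^sup>\<star> = 1 - z"
    using adj_add[of "1 - z" z] z(1) by (simp add: S_def eq_diff_eq)
  moreover have "(1 - z) * h = h * (1 - z)"
    using z(1) by (simp add: S_def left_diff_distrib right_diff_distrib)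
  ultimately show ?thesis using that by blast
qed

context
  fixes \<phi> :: "'a::cstar_algebra \<Rightarrow> 'b::cstar_algebra"
  assumes hom: "unital_star_hom \<phi>"
begin

lemma star_hom_simps:
  "\<phi> (x + y) = \<phi> x + \<phi> y" "\<phi> (c *\<^sub>C x) = c *\<^sub>C \<phi> x" "\<phi> (x * y) = \<phi> x * \<phi> y"
  "\<phi> (x\<^sup>\<star>) = (\<phi> x)\<^sup>\<star>" "\<phi> 1 = 1"
  using hom unfolding unital_star_hom_def by blast+

text \<open>If \<open>y\<close> is a selfadjoint square root of \<open>1 - h\<^sup>2\<close> commuting with \<open>h\<close>, then \<open>u = h + \<i> y\<close> satisfies
  \<open>u\<^sup>\<star> u = 1\<close> and \<open>2 h = u + u\<^sup>\<star>\<close>. Both equations survive under \<open>\<phi>\<close>, and an isometry has norm \<open>1\<close>.\<close>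

lemma star_hom_selfadjoint_le_one:
  assumes h: "h\<^sup>\<star> = h" "norm h < 1"
  shows "norm (\<phi> h) \<le> 1"
proof -
  obtain y where y: "y\<^sup>\<star> = y" "y * h = h * y" "y * y = 1 - h * h"
    using selfadjoint_sqrt[OF h] by blast
  define u where "u = h + \<i> *\<^sub>C y"
  have adj_u: "u\<^sup>\<star> = h + (- \<i>) *\<^sub>C y" by (simp add: u_def adj_add adj_scaleC h y)
  have neg: "(- 1) *\<^sub>C x = - x" "(- \<i>) *\<^sub>C x = - (\<i> *\<^sub>C x)" for x :: 'a
    using scaleC_scaleC[of "-1" \<i> x] by (simp_all add: scaleC_minus_one)
  have diff: "\<i> *\<^sub>C (x - x') = \<i> *\<^sub>C x - \<i> *\<^sub>C x'" for x x' :: 'a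
    using scaleC_add_right[of \<i> "x - x'" x'] by (simp add: eq_diff_eq)
  have "u\<^sup>\<star> * u = 1"
    unfolding adj_u unfolding u_def neg
    by (simp add: distrib_left distrib_right left_diff_distrib mult_scaleC_left mult_scaleC_right scaleC_scaleC y neg scaleC_one diff)
  then have "(\<phi> u)\<^sup>\<star> * \<phi> u = 1" by (metis star_hom_simps(3,4,5))
  then have "norm (\<phi> u) = 1" by (rule norm_isometry)
  moreover have "2 *\<^sub>R h = u + u\<^sup>\<star>"
    unfolding adj_u neg by (simp add: u_def scaleR_2)
  then have "2 *\<^sub>R \<phi> h = \<phi> u + (\<phi> u)\<^sup>\<star>" by (metis scaleR_scaleC star_hom_simps(1,2,4))
  then have "2 * norm (\<phi> h) \<le> norm (\<phi> u) + norm ((\<phi> u)\<^sup>\<star>)"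
    by (metis norm_triangle_ineq norm_scaleR abs_numeral)
  ultimately show ?thesis by (simp add: norm_adj)
qed

text \<open>The C*-identity reduces the claim to the selfadjoint element \<open>x\<^sup>\<star> x\<close>.\<close>

lemma star_hom_norm_le: "norm (\<phi> x) \<le> norm x"
proof (rule dense_ge)
  fix r assume r: "norm x < r"
  then have r0: "0 < r" using norm_ge_zero le_less_trans by blast
  define h where "h = complex_of_real (1 / r\<^sup>2) *\<^sub>C (x\<^sup>\<star> * x)"
  have "h\<^sup>\<star> = h" by (simp add: h_def adj_scaleC adj_mult adj_adj)
  moreover have "norm h < 1"
    using r r0 by (simp add: h_def norm_scaleC norm_adj_mult norm_divide norm_power power_strict_mono)
  ultimately have "norm (\<phi> h) \<le> 1" by (rule star_hom_selfadjoint_le_one)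
  then have "(norm (\<phi> x))\<^sup>2 \<le> r\<^sup>2"
    using r0 by (simp add: h_def star_hom_simps norm_scaleC norm_adj_mult norm_divide norm_power)
  then show "norm (\<phi> x) \<le> r" using r0 by (simp add: power2_le_iff_abs_le)
qed

lemma bounded_linear_star_hom: "bounded_linear \<phi>"
  by (rule bounded_linear_intro[of _ 1]) (simp_all add: star_hom_simps star_hom_norm_le scaleR_scaleC)

end

lemma cstar_subalgebra_fixed_points:
  fixes \<phi> :: "'a::cstar_algebra \<Rightarrow> 'a"
  assumes hom: "unital_star_hom \<phi>"
  shows "cstar_subalgebra {x. \<phi> x = x}"
proof -
  note bl = bounded_linear_star_hom[OF hom]
  have "closed {x. \<phi> x = x}"
    by (intro closed_Collect_eq continuous_intros bounded_linear.continuous_on[OF bl])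
  then show ?thesis
    by (simp add: cstar_subalgebra_def star_hom_simps[OF hom] linear_0[OF bounded_linear.linear[OF bl]])
qed

section \<open>Polynomials in an isometry\<close>

text \<open>\<open>\<Sum>\<^sub>i a\<^sub>i T\<^sup>i\<close> in Horner form, which suits induction on polynomials.\<close>

definition poly_at :: "'a::cstar_algebra \<Rightarrow> complex poly \<Rightarrow> 'a" where
  "poly_at T p = fold_coeffs (\<lambda>a x. a *\<^sub>C 1 + T * x) p 0"

lemma poly_at_0 [simp]: "poly_at T 0 = 0"
  by (simp add: poly_at_def)

lemma poly_at_pCons: "poly_at T (pCons a p) = a *\<^sub>C 1 + T * poly_at T p"
  by (cases "p = 0 \<and> a = 0") (auto simp: poly_at_def)

lemma poly_at_1 [simp]: "poly_at T 1 = 1"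
  by (simp add: poly_at_pCons one_pCons scaleC_one)

lemma poly_at_add: "poly_at T (p + q) = poly_at T p + poly_at T q"
  by (induction p q rule: poly_induct2) (simp_all add: poly_at_pCons scaleC_add_left algebra_simps)

lemma poly_at_smult: "poly_at T (smult c p) = c *\<^sub>C poly_at T p"
  by (induction p) (simp_all add: poly_at_pCons scaleC_add_right scaleC_scaleC mult_scaleC_right)

lemma poly_at_mult: "poly_at T (p * q) = poly_at T p * poly_at T q"
  by (induction p)
    (simp_all add: poly_at_add poly_at_smult poly_at_pCons distrib_right mult_scaleC_left mult.assoc)

lemma poly_at_power: "poly_at T (p ^ n) = poly_at T p ^ n"
  by (induction n) (simp_all add: poly_at_mult)

lemma poly_at_monom: "poly_at T (monom 1 n) = T ^ n"
  by (induction n) (simp_all add: monom_Suc poly_at_pCons monom_0 scaleC_one)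

lemma poly_at_commute: "x * T = T * x \<Longrightarrow> x * poly_at T p = poly_at T p * x"
proof (induction p)
  case (pCons a p)
  have "x * (T * poly_at T p) = T * poly_at T p * x"
    using pCons by (metis mult.assoc)
  then show ?case
    by (simp add: poly_at_pCons distrib_left distrib_right mult_scaleC_left mult_scaleC_right)
qed simp

lemma norm_poly_at_le:
  assumes "norm T = 1"
  shows "norm (poly_at T p) \<le> (\<Sum>i\<le>degree p. cmod (coeff p i))"
proof (induction p)
  case (pCons a p)
  have "norm (poly_at T (pCons a p)) \<le> cmod a + norm (poly_at T p)"
    unfolding poly_at_pCons using norm_mult_ineq[of T "poly_at T p"] assms
    by (intro order_trans[OF norm_triangle_ineq]) (simp add: norm_scaleC)
  also have "\<dots> \<le> (\<Sum>i\<le>degree (pCons a p). cmod (coeff (pCons a p) i))"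
    using pCons.IH by (cases "p = 0") (simp_all add: sum.atMost_Suc_shift del: sum.atMost_Suc)
  finally show ?case .
qed simp

text \<open>The isometries \<open>T\<^sup>i R\<close> have mutually orthogonal ranges, and \<open>poly_at T p * R\<close> is the combination
  of them with the coefficients of \<open>p\<close>.\<close>

lemma coeff_poly_at:
  assumes "T\<^sup>\<star> * T = 1" "R\<^sup>\<star> * R = 1" "R\<^sup>\<star> * T = 0"
  shows "R\<^sup>\<star> * (T\<^sup>\<star>) ^ i * poly_at T p * R = coeff p i *\<^sub>C 1"
proof (induction p arbitrary: i)
  case (pCons a p)
  have TR: "T\<^sup>\<star> * R = 0"
    using arg_cong[OF assms(3), of adj] by (simp add: adj_mult adj_adj adj_zero)
  show ?case
  proof (cases i)
    case 0
    have "R\<^sup>\<star> * (T * poly_at T p) = 0" by (simp add: assms flip: mult.assoc)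
    then show ?thesis using assms
      by (simp add: 0 poly_at_pCons distrib_left distrib_right mult_scaleC_left mult_scaleC_right mult.assoc)
  next
    case (Suc k)
    have "R\<^sup>\<star> * (T\<^sup>\<star>) ^ i * (T * poly_at T p) * R = R\<^sup>\<star> * (T\<^sup>\<star>) ^ k * (T\<^sup>\<star> * T) * poly_at T p * R"
      by (simp only: Suc power_Suc2 mult.assoc)
    moreover have "R\<^sup>\<star> * (T\<^sup>\<star>) ^ i * R = 0"
      by (simp only: Suc power_Suc2 mult.assoc TR) simp
    ultimately show ?thesis using pCons.IH[of k] assms(1)
      by (simp add: Suc poly_at_pCons distrib_left distrib_right mult_scaleC_left mult_scaleC_right
          del: power_Suc)
  qed
qed simp

text \<open>Let \<open>q = poly_at T p\<close>. Since \<open>H\<close> commutes with \<open>T\<close> and kills \<open>R\<close>, it kills \<open>q\<^sup>k R\<close>; there \<open>q\<close> acts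
  as \<open>q - H\<close>, whose norm is at most \<open>e\<close>. So \<open>\<parallel>q\<^sup>k R\<parallel> \<le> e\<^sup>k\<close>, which bounds each coefficient of \<open>p\<^sup>k\<close>. The
  number of coefficients grows linearly in \<open>k\<close>, a loss that disappears when roots are taken.\<close>

lemma norm_poly_at_power_le:
  assumes TR: "T\<^sup>\<star> * T = 1" "R\<^sup>\<star> * R = 1" "R\<^sup>\<star> * T = 0"
    and HT: "H * T = T * H" and HR: "H * R = 0"
    and e: "norm (H - poly_at T p) \<le> e"
  shows "norm (poly_at T p ^ k) \<le> (real (degree p * k) + 1) * e ^ k"
proof -
  let ?q = "poly_at T p"
  have n: "norm T = 1" "norm R = 1" using TR by (simp_all add: norm_isometry)
  have e0: "0 \<le> e" using e norm_ge_zero order_trans by blast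
  have H0: "H * (?q ^ k * R) = 0" for k
  proof -
    have "H * ?q ^ k = ?q ^ k * H"
      using poly_at_commute[OF HT, of "p ^ k"] by (simp add: poly_at_power)
    then show ?thesis by (metis HR mult.assoc mult_zero_right)
  qed
  have qR: "norm (?q ^ k * R) \<le> e ^ k" for k
  proof (induction k)
    case (Suc k)
    have "?q ^ Suc k * R = - ((H - ?q) * (?q ^ k * R))"
      by (simp add: left_diff_distrib H0 mult.assoc)
    then have "norm (?q ^ Suc k * R) \<le> norm (H - ?q) * norm (?q ^ k * R)"
      by (metis norm_minus_cancel norm_mult_ineq)
    also have "\<dots> \<le> e * e ^ k" using e Suc e0 by (intro mult_mono) auto
    finally show ?case by simp
  qed (simp add: n)
  have coeff: "cmod (coeff (p ^ k) i) \<le> e ^ k" for i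
  proof -
    let ?w = "R\<^sup>\<star> * (T\<^sup>\<star>) ^ i"
    have "norm ?w \<le> norm (R\<^sup>\<star>) * norm ((T\<^sup>\<star>) ^ i)" by (rule norm_mult_ineq)
    also have "\<dots> \<le> 1 * norm (T\<^sup>\<star>) ^ i" 
      by (intro mult_mono norm_power_ineq) (auto simp: norm_adj n)
    finally have w: "norm ?w \<le> 1" by (simp add: norm_adj n)
    have "cmod (coeff (p ^ k) i) = norm (?w * (?q ^ k * R))"
      using arg_cong[OF coeff_poly_at[OF TR, of i "p ^ k"], of norm]
      by (simp add: norm_scaleC poly_at_power mult.assoc)
    also have "\<dots> \<le> norm ?w * norm (?q ^ k * R)" by (rule norm_mult_ineq)
    also have "\<dots> \<le> 1 * e ^ k" using w qR[of k] by (intro mult_mono) auto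
    finally show ?thesis by simp
  qed
  have "norm (?q ^ k) \<le> (\<Sum>i\<le>degree (p ^ k). cmod (coeff (p ^ k) i))"
    using norm_poly_at_le[OF n(1), of "p ^ k"] by (simp add: poly_at_power)
  also have "\<dots> \<le> (real (degree (p ^ k)) + 1) * e ^ k"
    using sum_bounded_above[of "{..degree (p ^ k)}" "\<lambda>i. cmod (coeff (p ^ k) i)" "e ^ k"] coeff
    by (simp add: add.commute)
  also have "\<dots> \<le> (real (degree p * k) + 1) * e ^ k"
    using degree_power_le[of p k] e0 by (intro mult_right_mono) (auto simp flip: of_nat_mult)
  finally show ?thesis .
qed

text \<open>Expanding \<open>H\<^sup>N = (q + (H - q))\<^sup>N\<close> with commuting summands, both with powers of order \<open>e\<^sup>k\<close>, gives
  \<open>\<parallel>H\<^sup>N\<parallel> \<le> (d N + 1) (2 e)\<^sup>N\<close>. For normal \<open>H\<close> and \<open>N = 2\<^sup>j\<close> the left side is \<open>\<parallel>H\<parallel>\<^sup>N\<close>, and a linear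
  factor cannot keep up with a geometric one.\<close>

lemma norm_normal_le_near_poly_at:
  assumes TR: "T\<^sup>\<star> * T = 1" "R\<^sup>\<star> * R = 1" "R\<^sup>\<star> * T = 0"
    and HT: "H * T = T * H" and HR: "H * R = 0" and normal: "H\<^sup>\<star> * H = H * H\<^sup>\<star>"
    and e: "norm (H - poly_at T p) \<le> e" "0 < e"
  shows "norm H \<le> 2 * e"
proof (rule ccontr)
  assume "\<not> norm H \<le> 2 * e"
  define r where "r = norm H / (2 * e)"
  have r: "1 < r" using \<open>\<not> norm H \<le> 2 * e\<close> e(2) by (simp add: r_def)
  let ?q = "poly_at T p" and ?d = "real (degree p)"
  have Hq: "H * ?q = ?q * H" by (rule poly_at_commute[OF HT])
  have Hqk: "H * ?q ^ k = ?q ^ k * H" for k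
    by (metis Hq power_commuting_commutes)
  \<comment> \<open>The binomial expansion, one factor \<open>H = q + (H - q)\<close> at a time; the linear factor depends only
    on a bound \<open>n\<close> for the total degree, so that it does not accumulate.\<close>
  have mixed: "norm (?q ^ k * H ^ m) \<le> (?d * real n + 1) * e ^ k * (2 * e) ^ m" if "k + m \<le> n" for k m n
    using that
  proof (induction m arbitrary: k)
    case 0
    have "norm (?q ^ k) \<le> (?d * real k + 1) * e ^ k"
      using norm_poly_at_power_le[OF TR HT HR e(1), of k] by simp
    also have "\<dots> \<le> (?d * real n + 1) * e ^ k"
      using 0 e(2) by (intro mult_right_mono add_mono mult_left_mono) auto
    finally show ?case by simp
  next
    case (Suc m)
    have "?q ^ k * H ^ Suc m = ?q ^ Suc k * H ^ m + (H - ?q) * (?q ^ k * H ^ m)"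
      using Hqk[of k] by (simp add: left_diff_distrib flip: mult.assoc)
    then have "norm (?q ^ k * H ^ Suc m) \<le> norm (?q ^ Suc k * H ^ m) + norm (H - ?q) * norm (?q ^ k * H ^ m)"
      by (metis norm_triangle_le norm_mult_ineq add_left_mono)
    also have "\<dots> \<le> (?d * real n + 1) * e ^ Suc k * (2 * e) ^ m + e * ((?d * real n + 1) * e ^ k * (2 * e) ^ m)"
      using Suc.prems e by (intro add_mono mult_mono Suc.IH) auto
    also have "\<dots> = (?d * real n + 1) * e ^ k * (2 * e) ^ Suc m" by (simp add: algebra_simps)
    finally show ?case .
  qed
  have "r ^ (2 ^ j) \<le> ?d * real (2 ^ j) + 1" for j
    using mixed[of 0 "2 ^ j" "2 ^ j"] norm_normal_power[OF normal, of j] e(2)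
    by (simp add: r_def power_divide divide_le_eq)
  moreover have "eventually (\<lambda>n::nat. ?d * real n + 1 < r ^ n) sequentially"
    using r by real_asymp
  then obtain N where "\<And>n. n \<ge> N \<Longrightarrow> ?d * real n + 1 < r ^ n"
    by (auto simp: eventually_sequentially)
  then have "?d * real (2 ^ N) + 1 < r ^ (2 ^ N)" using less_exp[of N] by (meson less_imp_le)
  ultimately show False by (meson not_less)
qed

text \<open>As \<open>F\<close> vanishes on the range of \<open>R\<close>, it lives on the range of \<open>T\<close>, and by commutation on that of
  every \<open>T\<^sup>n\<close>: \<open>F = F T\<^sup>n (T\<^sup>\<star>)\<^sup>n\<close>. So \<open>F T\<^sup>n\<close> is again normal and has the norm of \<open>F\<close>.\<close>

lemma normal_commutant_zero:
  assumes TR: "T\<^sup>\<star> * T = 1" "R\<^sup>\<star> * R = 1" "T * T\<^sup>\<star> + R * R\<^sup>\<star> = 1"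
    and FT: "F * T = T * F" and FR: "F * R = 0" and normal: "F\<^sup>\<star> * F = F * F\<^sup>\<star>"
    and approx: "\<And>e. 0 < e \<Longrightarrow> \<exists>n p. norm (F * T ^ n - poly_at T p) \<le> e"
  shows "F = 0"
proof -
  have RT: "R\<^sup>\<star> * T = 0"
  proof -
    have "T\<^sup>\<star> * (T * T\<^sup>\<star> + R * R\<^sup>\<star>) * T = T\<^sup>\<star> * T" by (simp add: TR)
    then have "(R\<^sup>\<star> * T)\<^sup>\<star> * (R\<^sup>\<star> * T) = 0"
      using TR(1) by (simp add: distrib_left distrib_right adj_mult adj_adj flip: mult.assoc)
    then show ?thesis using norm_adj_mult[of "R\<^sup>\<star> * T"] by simp
  qed
  have "norm F \<le> 2 * e" if e: "0 < e" for e
  proof -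
    obtain n p where np: "norm (F * T ^ n - poly_at T p) \<le> e" using approx[OF e] by blast
    have FTn: "F * T ^ k = T ^ k * F" for k by (metis FT power_commuting_commutes)
    have FTT: "F * T ^ k * (T\<^sup>\<star>) ^ k = F" for k
    proof (induction k)
      case (Suc k)
      have "F * (T * T\<^sup>\<star>) = F * (T * T\<^sup>\<star> + R * R\<^sup>\<star>)"
        by (simp add: distrib_left FR flip: mult.assoc)
      then have F: "F * (T * T\<^sup>\<star>) = F" by (simp add: TR(3))
      have "F * T ^ Suc k * (T\<^sup>\<star>) ^ Suc k = T ^ k * (F * (T * T\<^sup>\<star>)) * (T\<^sup>\<star>) ^ k"
        by (simp only: power_Suc2[of T] power_Suc[of "T\<^sup>\<star>"] mult.assoc flip: FTn)
          (simp only: FTn mult.assoc flip: mult.assoc[of F "T ^ k"])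
      then show ?case using Suc F FTn by simp
    qed simp
    let ?H = "F * T ^ n"
    \<comment> \<open>Two forms of the adjoint: the second one cancels \<open>T\<^sup>n\<close> in \<open>?H\<^sup>\<star> * ?H\<close>, the first one
      restores \<open>T\<^sup>n (T\<^sup>\<star>)\<^sup>n\<close> in \<open>?H * ?H\<^sup>\<star>\<close>.\<close>
    have adjH: "?H\<^sup>\<star> = (T\<^sup>\<star>) ^ n * F\<^sup>\<star>" by (simp add: adj_mult adj_power)
    have adjH': "?H\<^sup>\<star> = F\<^sup>\<star> * (T\<^sup>\<star>) ^ n" by (simp add: FTn adj_mult adj_power)
    have "?H\<^sup>\<star> * ?H = F\<^sup>\<star> * ((T\<^sup>\<star>) ^ n * T ^ n) * F" by (simp only: adjH') (simp add: FTn mult.assoc)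
    also have "\<dots> = F * F\<^sup>\<star>" using isometry_power[OF TR(1), of n] normal by simp
    also have "\<dots> = ?H * ?H\<^sup>\<star>" using FTT[of n] by (simp only: adjH mult.assoc[symmetric])
    finally have H: "?H\<^sup>\<star> * ?H = ?H * ?H\<^sup>\<star>" .
    have "norm ?H \<le> 2 * e"
    proof (rule norm_normal_le_near_poly_at[OF TR(1,2) RT _ _ H np e])
      show "?H * T = T * ?H" using FT by (metis mult.assoc power_commutes)
      show "?H * R = 0" by (simp add: FTn FR mult.assoc)
    qed
    moreover have "norm F \<le> norm ?H * norm ((T\<^sup>\<star>) ^ n)" using norm_mult_ineq[of ?H "(T\<^sup>\<star>) ^ n"] FTT[of n] by simp
    moreover have "norm ((T\<^sup>\<star>) ^ n) \<le> 1"
      using norm_power_ineq[of "T\<^sup>\<star>" n] norm_isometry[OF TR(1)] by (simp add: norm_adj)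
    ultimately show ?thesis by (smt (verit) mult_left_le norm_ge_zero)
  qed
  note le = this
  have "norm F \<le> 0" by (rule dense_ge) (use le[of "e / 2" for e] in simp)
  then show ?thesis by simp
qed

section \<open>Compressions of words\<close>

text \<open>Negative exponents are expressed by the adjoint, which is the inverse when \<open>V\<close> is unitary.\<close>

definition unitary_power :: "'a::cstar_algebra \<Rightarrow> int \<Rightarrow> 'a" where
  "unitary_power V k = (if 0 \<le> k then V ^ nat k else (V\<^sup>\<star>) ^ nat (- k))"

context
  fixes V T :: "'a::cstar_algebra"
  assumes rel: "Q2_relations V T"
begin

lemma rels: "V\<^sup>\<star> * V = 1" "V * V\<^sup>\<star> = 1" "T\<^sup>\<star> * T = 1" "T * V = V * V * T"
  "T * T\<^sup>\<star> + V * T * T\<^sup>\<star> * V\<^sup>\<star> = 1"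
  using rel by (simp_all add: Q2_relations_def power2_eq_square)

lemma unitary_power_0 [simp]: "unitary_power V 0 = 1"
  by (simp add: unitary_power_def)

lemma unitary_power_add_one: "V * unitary_power V k = unitary_power V (k + 1)"
proof (cases "0 \<le> k")
  case True
  then show ?thesis by (simp add: unitary_power_def nat_add_distrib)
next
  case False
  then have "nat (- k) = Suc (nat (- (k + 1)))" by simp
  moreover have "V * (V\<^sup>\<star> * x) = x" for x by (simp add: rels flip: mult.assoc)
  ultimately show ?thesis using False by (auto simp: unitary_power_def simp del: minus_add_distrib)
qed

lemma unitary_power_diff_one: "V\<^sup>\<star> * unitary_power V k = unitary_power V (k - 1)"
  using unitary_power_add_one[of "k - 1"] rels(1) by (metis diff_add_cancel mult.assoc mult_1)

lemma isometry_unitary_adj: "T * V\<^sup>\<star> = V\<^sup>\<star> * V\<^sup>\<star> * T"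
proof -
  have "V\<^sup>\<star> * V\<^sup>\<star> * T = V\<^sup>\<star> * V\<^sup>\<star> * (T * V) * V\<^sup>\<star>" using rels(2) by (simp add: mult.assoc)
  also have "\<dots> = V\<^sup>\<star> * (V\<^sup>\<star> * V) * V * T * V\<^sup>\<star>" by (simp only: rels(4) mult.assoc)
  finally show ?thesis using rels(1) by simp
qed

lemma isometry_unitary_power: "T * unitary_power V k = unitary_power V (2 * k) * T"
proof (induction k rule: int_induct[of _ 0])
  case (step1 k)
  have "T * unitary_power V (k + 1) = V * (V * (T * unitary_power V k))"
    by (metis rels(4) unitary_power_add_one mult.assoc)
  also have "\<dots> = unitary_power V (2 * k + 1 + 1) * T"
    by (simp only: step1 flip: mult.assoc) (simp only: unitary_power_add_one mult.assoc[of V V] flip: mult.assoc)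
  finally show ?case by (simp add: algebra_simps)
next
  case (step2 k)
  have "T * unitary_power V (k - 1) = V\<^sup>\<star> * (V\<^sup>\<star> * (T * unitary_power V k))"
    by (metis isometry_unitary_adj unitary_power_diff_one mult.assoc)
  also have "\<dots> = unitary_power V (2 * k - 1 - 1) * T"
    by (simp only: step2 flip: mult.assoc) (simp only: unitary_power_diff_one mult.assoc[of "V\<^sup>\<star>" "V\<^sup>\<star>"] flip: mult.assoc)
  finally show ?case by (simp add: algebra_simps)
qed simp

text \<open>Multiplying the range relation by \<open>T\<^sup>\<star>\<close> on the left and \<open>V T\<close> on the right counts \<open>T\<^sup>\<star> V T\<close>
  twice.\<close>

lemma isometry_ranges_orthogonal: "T\<^sup>\<star> * (V * T) = 0"
proof -
  have "T\<^sup>\<star> * (T * T\<^sup>\<star> + V * T * T\<^sup>\<star> * V\<^sup>\<star>) * (V * T) = T\<^sup>\<star> * (V * T)" by (simp add: rels(5))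
  moreover have "T\<^sup>\<star> * (V * T * T\<^sup>\<star> * V\<^sup>\<star>) * (V * T) = T\<^sup>\<star> * V * T * T\<^sup>\<star> * (V\<^sup>\<star> * V) * T"
    by (simp only: mult.assoc)
  moreover have "T\<^sup>\<star> * (T * T\<^sup>\<star>) * (V * T) = (T\<^sup>\<star> * T) * T\<^sup>\<star> * (V * T)"
    by (simp only: mult.assoc)
  ultimately have "T\<^sup>\<star> * (V * T) + T\<^sup>\<star> * V * T * (T\<^sup>\<star> * T) = T\<^sup>\<star> * (V * T)"
    by (simp add: rels(1,3) distrib_left distrib_right mult.assoc)
  then show ?thesis by (simp add: rels(3) mult.assoc)
qed

lemma compress_even: "T\<^sup>\<star> * unitary_power V (2 * b) * T = unitary_power V b"
proof -
  have "T\<^sup>\<star> * unitary_power V (2 * b) * T = (T\<^sup>\<star> * T) * unitary_power V b"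
    by (simp only: mult.assoc isometry_unitary_power)
  then show ?thesis by (simp add: rels(3))
qed

lemma compress_odd: "T\<^sup>\<star> * unitary_power V (2 * b + 1) * T = 0"
proof -
  have "T\<^sup>\<star> * unitary_power V (2 * b + 1) * T = T\<^sup>\<star> * (V * T) * unitary_power V b"
    by (simp only: mult.assoc isometry_unitary_power flip: unitary_power_add_one)
  then show ?thesis by (simp add: isometry_ranges_orthogonal)
qed

text \<open>Each compression by \<open>T\<close> halves an even exponent and annihilates an odd one; a nonzero exponent
  below \<open>2\<^sup>n\<close> becomes odd within \<open>n\<close> halvings.\<close>

lemma compress_small_power:
  assumes "a \<noteq> 0" "\<bar>a\<bar> < 2 ^ n"
  shows "(T\<^sup>\<star>) ^ n * unitary_power V a * T ^ n = 0"
  using assms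
proof (induction n arbitrary: a)
  case (Suc n)
  have step: "(T\<^sup>\<star>) ^ Suc n * unitary_power V a * T ^ Suc n
      = (T\<^sup>\<star>) ^ n * (T\<^sup>\<star> * unitary_power V a * T) * T ^ n"
    by (simp only: power_Suc2[of "T\<^sup>\<star>"] power_Suc[of T] mult.assoc)
  show ?case
  proof (cases "even a")
    case True
    then obtain b where "a = 2 * b" by blast
    then show ?thesis using Suc.IH[of b] Suc.prems step by (simp add: compress_even)
  next
    case False
    then obtain b where "a = 2 * b + 1" by (rule oddE)
    then show ?thesis using step by (simp add: compress_odd)
  qed
qed simp

text \<open>Read from the right, each letter of the word sends \<open>V\<^sup>a T\<^sup>m\<close> to an element of the same form or to
  zero. A letter \<open>T\<^sup>\<star>\<close> has to consume a factor \<open>T\<close>; the power \<open>T\<^sup>N\<close> on the right supplies these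
  factors.\<close>

lemma word_val_isometry_power:
  obtains N where "word_val V T (Word ls) * T ^ N = 0"
  | N a m where "word_val V T (Word ls) * T ^ N = unitary_power V a * T ^ m"
proof -
  have "\<exists>N. word_val V T (Word ls) * T ^ N = 0 \<or>
      (\<exists>a m. word_val V T (Word ls) * T ^ N = unitary_power V a * T ^ m)"
  proof (induction ls)
    case Nil
    show ?case by (intro exI[of _ 0] disjI2) (simp add: word_val_def)
  next
    case (Cons l ls)
    let ?w = "word_val V T (Word ls)"
    have w: "word_val V T (Word (l # ls)) * x = letter_val V T l * (?w * x)" for x
      by (simp add: word_val_def mult.assoc)
    from Cons obtain N where N: "?w * T ^ N = 0 \<or> (\<exists>a m. ?w * T ^ N = unitary_power V a * T ^ m)" by blast
    show ?case
    proof (cases "?w * T ^ N = 0")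
      case True
      then show ?thesis by (intro exI[of _ N]) (simp add: w)
    next
      case False
      then obtain a m where am: "?w * T ^ N = unitary_power V a * T ^ m" using N by blast
      show ?thesis
      proof (cases l)
        case LU
        then show ?thesis
          by (metis w am unitary_power_add_one mult.assoc letter_val.simps(1))
      next
        case LUadj
        then show ?thesis
          by (metis w am unitary_power_diff_one mult.assoc letter_val.simps(2))
      next
        case LS
        have "word_val V T (Word (l # ls)) * T ^ N = unitary_power V (2 * a) * T ^ Suc m"
          unfolding w am by (simp add: LS isometry_unitary_power flip: mult.assoc)
        then show ?thesis by blast
      next
        case LSadj
        have *: "word_val V T (Word (l # ls)) * T ^ Suc N = T\<^sup>\<star> * unitary_power V a * T * T ^ m"
        proof -
          have "?w * T ^ Suc N = (?w * T ^ N) * T" by (simp only: power_Suc2 mult.assoc)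
          also have "\<dots> = unitary_power V a * (T * T ^ m)"
            by (simp only: am mult.assoc power_commutes)
          finally show ?thesis unfolding w by (simp only: LSadj letter_val.simps mult.assoc)
        qed
        show ?thesis
        proof (cases "even a")
          case True
          then obtain b where "a = 2 * b" by blast
          then show ?thesis using * by (metis compress_even)
        next
          case False
          then obtain b where "a = 2 * b + 1" by (rule oddE)
          then show ?thesis using * by (metis compress_odd mult_zero_left)
        qed
      qed
    qed
  qed
  then show ?thesis using that by blast
qed

text \<open>One factor \<open>T\<^sup>n\<close> on the right balances \<open>(T\<^sup>\<star>)\<^sup>n\<close>; the second one absorbs the powers of \<open>T\<^sup>\<star>\<close> in the
  word, so that the result contains no adjoints.\<close>

lemma word_val_compression:
  "\<forall>\<^sub>F n in sequentially. \<exists>p. (T\<^sup>\<star>) ^ n * word_val V T (Word ls) * T ^ (2 * n) = poly_at T p"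
proof (cases rule: word_val_isometry_power[of ls])
  case (1 N)
  have "(T\<^sup>\<star>) ^ n * word_val V T (Word ls) * T ^ (2 * n) = poly_at T 0" if "N \<le> n" for n
  proof -
    have "T ^ (2 * n) = T ^ N * T ^ (2 * n - N)" using that by (simp flip: power_add)
    then show ?thesis using 1 by (simp add: mult.assoc) (simp flip: mult.assoc)
  qed
  then show ?thesis unfolding eventually_sequentially by blast
next
  case (2 N a m)
  have "\<exists>p. (T\<^sup>\<star>) ^ n * word_val V T (Word ls) * T ^ (2 * n) = poly_at T p"
    if n: "max N (nat \<bar>a\<bar>) \<le> n" for n
  proof -
    have "T ^ (2 * n) = T ^ N * T ^ (2 * n - N)" using n by (simp flip: power_add)
    then have "(T\<^sup>\<star>) ^ n * word_val V T (Word ls) * T ^ (2 * n)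
        = (T\<^sup>\<star>) ^ n * (word_val V T (Word ls) * T ^ N) * T ^ (2 * n - N)"
      by (simp only: mult.assoc)
    also have "\<dots> = (T\<^sup>\<star>) ^ n * unitary_power V a * (T ^ m * T ^ (2 * n - N))"
      by (simp only: 2 mult.assoc)
    also have "T ^ m * T ^ (2 * n - N) = T ^ n * T ^ (m + n - N)"
    proof -
      have "m + (2 * n - N) = n + (m + n - N)" using n by simp
      then show ?thesis by (metis power_add)
    qed
    finally have eq: "(T\<^sup>\<star>) ^ n * word_val V T (Word ls) * T ^ (2 * n)
        = (T\<^sup>\<star>) ^ n * unitary_power V a * T ^ n * T ^ (m + n - N)" by (simp only: mult.assoc)
    show ?thesis
    proof (cases "a = 0")
      case True
      then have "(T\<^sup>\<star>) ^ n * word_val V T (Word ls) * T ^ (2 * n) = poly_at T (monom 1 (m + n - N))"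
        using eq isometry_power[OF rels(3), of n] by (simp add: poly_at_monom)
      then show ?thesis by blast
    next
      case False
      have "\<bar>a\<bar> \<le> int n" using n by linarith
      also have "int n < 2 ^ n" by (metis of_nat_less_two_power)
      finally have "(T\<^sup>\<star>) ^ n * word_val V T (Word ls) * T ^ (2 * n) = poly_at T 0"
        using eq compress_small_power[OF False] by simp
      then show ?thesis by blast
    qed
  qed
  then show ?thesis unfolding eventually_sequentially by blast
qed

text \<open>The statement holds for all large \<open>n\<close>, so one \<open>n\<close> serves all words of a linear combination.\<close>

lemma free_val_compression:
  "\<forall>\<^sub>F n in sequentially. \<exists>p. (T\<^sup>\<star>) ^ n * free_val V T f * T ^ (2 * n) = poly_at T p"
proof (induction f rule: free_induct)
  case (add f g)
  then show ?case
  proof eventually_elim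
    case (elim n)
    then obtain p q where "(T\<^sup>\<star>) ^ n * free_val V T f * T ^ (2 * n) = poly_at T p"
      "(T\<^sup>\<star>) ^ n * free_val V T g * T ^ (2 * n) = poly_at T q" by blast
    then have "(T\<^sup>\<star>) ^ n * free_val V T (f + g) * T ^ (2 * n) = poly_at T (p + q)"
      by (simp add: free_val_add poly_at_add distrib_left distrib_right)
    then show ?case by blast
  qed
next
  case (single w c)
  obtain ls where w: "w = Word ls" by (cases w)
  show ?case using word_val_compression[of ls]
  proof eventually_elim
    case (elim n)
    then obtain p where "(T\<^sup>\<star>) ^ n * word_val V T (Word ls) * T ^ (2 * n) = poly_at T p" by blast
    then have "(T\<^sup>\<star>) ^ n * free_val V T (Poly_Mapping.single w c) * T ^ (2 * n) = poly_at T (smult c p)"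
      by (simp add: w free_val_single poly_at_smult mult_scaleC_left mult_scaleC_right)
    then show ?case by blast
  qed
qed

end

lemma of_free_eq_free_val: "of_free f = free_val U S\<^sub>2 f"
proof (induction f rule: free_induct)
  case (single w c)
  have letter: "of_free (free_letter l) = letter_val U S\<^sub>2 l" for l
    by (cases l) (simp_all add: U_def S\<^sub>2_def adj_Q2_def flip: of_free_adj)
  have "of_free (Poly_Mapping.single (Word ls) 1) = word_val U S\<^sub>2 (Word ls)" for ls
  proof (induction ls)
    case Nil
    then show ?case by (simp add: of_free_one word_val_def flip: zero_word_def)
  next
    case (Cons l ls)
    have "Poly_Mapping.single (Word (l # ls)) 1 = free_letter l * Poly_Mapping.single (Word ls) 1"
      by (simp add: free_letter_def mult_single plus_word_def)
    then show ?case using Cons letter by (simp add: of_free_mult word_val_def)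
  qed
  then have "of_free (Poly_Mapping.single w 1) = word_val U S\<^sub>2 w" by (cases w) simp
  then show ?case
    using of_free_scale[of c "Poly_Mapping.single w 1"] by (simp add: free_val_single scaleC_Q2_def)
qed (simp add: of_free_add free_val_add)

lemma compression_near_poly_at:
  assumes "0 < e"
  shows "\<exists>n p. norm ((S\<^sub>2\<^sup>\<star>) ^ n * x * S\<^sub>2 ^ (2 * n) - poly_at S\<^sub>2 p) \<le> e"
proof -
  obtain f where f: "norm (x - of_free f) < e" using of_free_dense[OF assms] by blast
  obtain n p where np: "(S\<^sub>2\<^sup>\<star>) ^ n * of_free f * S\<^sub>2 ^ (2 * n) = poly_at S\<^sub>2 p"
    using eventually_happens[OF free_val_compression[OF Q2_relations_generators, of f]]
    by (auto simp: of_free_eq_free_val)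
  have "norm S\<^sub>2 = 1" by (intro norm_isometry rels(3)[OF Q2_relations_generators])
  then have n: "norm (S\<^sub>2 ^ k) \<le> 1" "norm ((S\<^sub>2\<^sup>\<star>) ^ k) \<le> 1" for k
    using norm_power_ineq[of S\<^sub>2 k] norm_power_ineq[of "S\<^sub>2\<^sup>\<star>" k] by (simp_all add: norm_adj)
  have "norm ((S\<^sub>2\<^sup>\<star>) ^ n * x * S\<^sub>2 ^ (2 * n) - poly_at S\<^sub>2 p)
      = norm ((S\<^sub>2\<^sup>\<star>) ^ n * (x - of_free f) * S\<^sub>2 ^ (2 * n))"
    by (simp add: np left_diff_distrib right_diff_distrib)
  also have "\<dots> \<le> norm ((S\<^sub>2\<^sup>\<star>) ^ n) * norm (x - of_free f) * norm (S\<^sub>2 ^ (2 * n))"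
    by (meson norm_mult_ineq mult_right_mono norm_ge_zero order_trans)
  also have "\<dots> \<le> 1 * norm (x - of_free f) * 1"
    by (intro mult_mono n) auto
  finally show ?thesis using f by (metis less_imp_le mult_1 mult.right_neutral order_trans)
qed

section \<open>Rigidity of the Cuntz algebra\<close>

text \<open>The relations make \<open>F = V U\<^sup>\<star> - 1\<close> commute with \<open>S\<^sub>2\<close> and kill \<open>S\<^sub>1\<close>, while \<open>F\<close> is normal because
  \<open>V U\<^sup>\<star>\<close> is unitary.\<close>

lemma unitary_eq_generator:
  assumes V: "V\<^sup>\<star> * V = 1" "V * V\<^sup>\<star> = 1" and VS: "V * S\<^sub>2 = U * S\<^sub>2" and SV: "S\<^sub>2 * V = V * V * S\<^sub>2"
  shows "V = U"
proof -
  note R = rels[OF Q2_relations_generators] and SU = isometry_unitary_adj[OF Q2_relations_generators]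
  define F where "F = V * U\<^sup>\<star> - 1"
  have inv: "U\<^sup>\<star> * (U * x) = x" "U * (U\<^sup>\<star> * x) = x" "V\<^sup>\<star> * (V * x) = x" "V * (V\<^sup>\<star> * x) = x" for x
    by (simp_all add: V R(1,2) flip: mult.assoc)
  have "F = 0"
  proof (rule normal_commutant_zero[where T = S\<^sub>2 and R = S\<^sub>1])
    show "S\<^sub>2\<^sup>\<star> * S\<^sub>2 = 1" by (rule R)
    show "S\<^sub>1\<^sup>\<star> * S\<^sub>1 = 1" by (simp add: S\<^sub>1_def adj_mult mult.assoc inv R(3))
    show "S\<^sub>2 * S\<^sub>2\<^sup>\<star> + S\<^sub>1 * S\<^sub>1\<^sup>\<star> = 1" using R(5) by (simp add: S\<^sub>1_def adj_mult mult.assoc)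
    show "F * S\<^sub>1 = 0" by (simp add: F_def S\<^sub>1_def left_diff_distrib mult.assoc inv VS)
    show comm: "F * S\<^sub>2 = S\<^sub>2 * F"
    proof -
      have "S\<^sub>2 * (V * U\<^sup>\<star>) = V * (V * S\<^sub>2) * U\<^sup>\<star>" by (simp add: SV flip: mult.assoc)
      also have "\<dots> = V * U * (S\<^sub>2 * U\<^sup>\<star>)" by (simp add: VS mult.assoc)
      also have "\<dots> = V * U\<^sup>\<star> * S\<^sub>2" by (simp add: SU mult.assoc inv)
      finally show ?thesis by (simp add: F_def left_diff_distrib right_diff_distrib)
    qed
    have adjF: "F\<^sup>\<star> = U * V\<^sup>\<star> - 1"
      using adj_add[of F 1] by (simp add: F_def adj_mult adj_adj algebra_simps)
    show "F\<^sup>\<star> * F = F * F\<^sup>\<star>"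
      unfolding adjF by (simp add: F_def left_diff_distrib right_diff_distrib mult.assoc inv V R(1,2))
    fix e :: real assume "0 < e"
    then obtain n p where np: "norm ((S\<^sub>2\<^sup>\<star>) ^ n * F * S\<^sub>2 ^ (2 * n) - poly_at S\<^sub>2 p) \<le> e"
      using compression_near_poly_at by blast
    have "F * S\<^sub>2 ^ n = S\<^sub>2 ^ n * F" by (metis comm power_commuting_commutes)
    then have "(S\<^sub>2\<^sup>\<star>) ^ n * F * S\<^sub>2 ^ (2 * n) = ((S\<^sub>2\<^sup>\<star>) ^ n * S\<^sub>2 ^ n) * F * S\<^sub>2 ^ n"
      by (simp only: mult_2 power_add) (simp add: mult.assoc flip: mult.assoc[of F])
    then have "(S\<^sub>2\<^sup>\<star>) ^ n * F * S\<^sub>2 ^ (2 * n) = F * S\<^sub>2 ^ n"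
      by (simp add: isometry_power[OF R(3)])
    then show "\<exists>n p. norm (F * S\<^sub>2 ^ n - poly_at S\<^sub>2 p) \<le> e" using np by metis
  qed
  then have "V * U\<^sup>\<star> * U = U" by (simp add: F_def)
  then show ?thesis by (simp add: mult.assoc R(1))
qed

theorem theorem4p5:
  fixes \<Lambda> :: "Q2 \<Rightarrow> Q2"
  assumes "unital_star_hom \<Lambda>"
    and "\<And>x. x \<in> O\<^sub>2 \<Longrightarrow> \<Lambda> x = x"
  shows "\<Lambda> = id"
proof -
  note hom = star_hom_simps[OF assms(1)] and R = rels[OF Q2_relations_generators]
  have gen: "S\<^sub>1 \<in> O\<^sub>2" "S\<^sub>2 \<in> O\<^sub>2"
    using cstar_generated_superset[of "{S\<^sub>1, S\<^sub>2}"] by (auto simp: O\<^sub>2_def)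
  then have S: "\<Lambda> S\<^sub>1 = S\<^sub>1" "\<Lambda> S\<^sub>2 = S\<^sub>2" by (simp_all add: assms(2))
  have "\<Lambda> U = U"
  proof (rule unitary_eq_generator)
    show "(\<Lambda> U)\<^sup>\<star> * \<Lambda> U = 1" "\<Lambda> U * (\<Lambda> U)\<^sup>\<star> = 1" using R(1,2) by (metis hom(3,4,5))+
    show "\<Lambda> U * S\<^sub>2 = U * S\<^sub>2" using S by (metis S\<^sub>1_def hom(3))
    show "S\<^sub>2 * \<Lambda> U = \<Lambda> U * \<Lambda> U * S\<^sub>2" using R(4) S(2) by (metis hom(3))
  qed
  with S(2) have "cstar_generated {U, S\<^sub>2} \<subseteq> {x. \<Lambda> x = x}"
    unfolding cstar_generated_def
    by (intro hull_minimal cstar_subalgebra_fixed_points assms(1)) auto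
  then show ?thesis by (auto simp: Q2_generated fun_eq_iff)
qed

end
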